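(* Let $q$ be a prime power with $2\mid q$ and let $n\ge2$ with $\gcd(q,n)=1$. With the notation of the context, let $I\subset\mathbb{F}_qD_n$ be a dihedral code and $\mathcal{P}(I)=\bigoplus_{j=1}^{r+s}B_j$ with $B_j$ a left ideal of $A_j$. Then $I$ is self-dual (i.e. $I=I^\perp$) if and only if $B_j\ne0$ and $B_j\neq A_j$ for all $1\le j\le r+s$.
   Context: $D_n=\langle a,b\mid a^n=1,\ b^2=1,\ bab=a^{-1}\rangle$ is the dihedral group of order $2n$, $\mathbb{F}_qD_n$ its group algebra; every element is uniquely $P(a)+bQ(a)$ with $P,Q\in\mathbb{F}_q[x]$ of degree less than $n$. A dihedral code is a left ideal of $\mathbb{F}_qD_n$. The dot product on $\mathbb{F}_qD_n$ is $\left(\sum_g x_gg,\sum_g y_gg\right)\mapsto\sum_{g\in D_n}x_gy_g$, and $C^\perp=\{x\in\mathbb{F}_qD_n\mid \text{the dot product of } c \text{ and } x \text{ is } 0 \text{ for all } c\in C\}$. For $g\in\mathbb{F}_q[x]$ with $g(0)\neq0$ put $g^*(x)=x^{\deg g}g(x^{-1})$. Factor $x^n-1$ over $\mathbb{F}_q$ into (pairwise distinct) monic irreducible factors as $x^n-1=(f_1f_2\cdots f_r)(f_{r+1}f_{r+1}^*\cdots f_{r+s}f_{r+s}^* )$, where $f_1=x-1$, $f_2=x+1$ if $n$ is even, $f_j^*=f_j$ for $1<j\le r$, and for $j>r$ the polynomials $f_j$ and $f_j^*$ have different roots (here the factor $f_j^*$, $j>r$, is normalized by a scalar to be monic). Let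 $\alpha_j$ be a root of $f_j$. Let $\zeta(n)=1$ if $n$ is odd, $\zeta(n)=2$ if $n$ is even. $\langle h\mid h^2\rangle$ is the cyclic group of order 2 generated by $h$. Put $A_j=\mathbb{F}_q\langle h\mid h^2\rangle$ for $1\le j\le\zeta(n)$, $A_j=\mathrm{M}_2(\mathbb{F}_q[\alpha_j+\alpha_j^{-1}])$ for $\zeta(n)+1\le j\le r$, $A_j=\mathrm{M}_2(\mathbb{F}_q[\alpha_j])$ for $r+1\le j\le r+s$. Define for $u=P(a)+bQ(a)$: $\gamma_1(u)=P(1)+Q(1)h$; $\gamma_2(u)=P(-1)+Q(-1)h$ (for $n$ even); for $j\ge\zeta(n)+1$, $\tau_j(u)=\begin{pmatrix}P(\alpha_j)&Q(\alpha_j^{-1})\\Q(\alpha_j)&P(\alpha_j^{-1})\end{pmatrix}$; for $\zeta(n)+1\le j\le r$, $\sigma_j(X)=Z_j^{-1}XZ_j$ with $Z_j=\begin{pmatrix}1&-\alpha_j\\1&-\alpha_j^{-1}\end{pmatrix}$. Put $\mathcal{P}_j=\gamma_j$ for $j\le\zeta(n)$, $\mathcal{P}_j=\sigma_j\tau_j$ for $\zeta(n)+1\le j\le r$, $\mathcal{P}_j=\tau_j$ for $r+1\le j\le r+s$. It is known that $\mathcal{P}=\bigoplus_{j=1}^{r+s}\mathcal{P}_j:\mathbb{F}_qD_n\to\bigoplus_{j=1}^{r+s}A_j$ is an algebra isomorphism. The image $\mathcal{P}(I)$ of a left ideal is uniquely a direct sum of left ideals $B_j$ of the $A_j$. *)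

theory Defs
  imports
    "HOL-Analysis.Cartesian_Space"
    "HOL-Algebra.Elementary_Groups"
    "HOL-Algebra.Weak_Morphisms"
    "HOL-Algebra.Algebraic_Closure_Type"
begin

section \<open>Group algebras of finite groups and left ideals\<close>

text \<open>For a finite group \<open>G\<close>, the element \<open>\<Sum>\<^sub>g x\<^sub>g g\<close> of the group algebra is the
  function \<open>g \<mapsto> x\<^sub>g\<close>, extended by \<open>0\<close> outside the carrier.\<close>

definition group_algebra :: "('g, 'm) monoid_scheme \<Rightarrow> ('g \<Rightarrow> 'k::field) ring" where
  "group_algebra G =
    \<lparr> carrier = {u. \<forall>g. g \<notin> carrier G \<longrightarrow> u g = 0},
      monoid.mult = (\<lambda>u v g. if g \<in> carrier G
        then (\<Sum>h\<in>carrier G. u h * v (inv\<^bsub>G\<^esub> h \<otimes>\<^bsub>G\<^esub> g)) else 0),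
      one = (\<lambda>g. if g = \<one>\<^bsub>G\<^esub> then 1 else 0),
      ring.zero = (\<lambda>_. 0),
      add = (\<lambda>u v g. u g + v g) \<rparr>"

definition left_ideal :: "'a set \<Rightarrow> ('a, 'm) ring_scheme \<Rightarrow> bool" where
  "left_ideal I R \<longleftrightarrow>
    additive_subgroup I R \<and> (\<forall>x\<in>carrier R. \<forall>y\<in>I. x \<otimes>\<^bsub>R\<^esub> y \<in> I)"

definition dot_product ::
  "('g, 'm) monoid_scheme \<Rightarrow> ('g \<Rightarrow> 'k::field) \<Rightarrow> ('g \<Rightarrow> 'k) \<Rightarrow> 'k" where
  "dot_product G x y = (\<Sum>g\<in>carrier G. x g * y g)"

definition dual_code :: "('g, 'm) monoid_scheme \<Rightarrow> ('g \<Rightarrow> 'k::field) set \<Rightarrow> ('g \<Rightarrow> 'k) set" where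
  "dual_code G C = {x \<in> carrier (group_algebra G). \<forall>c\<in>C. dot_product G c x = 0}"

lemma group_algebra_ring:
  assumes "group G" "finite (carrier G)"
  shows "Ring.ring (group_algebra G :: ('g \<Rightarrow> 'k::field) ring)"
proof -
  interpret G: group G by (rule assms)
  let ?R = "group_algebra G :: ('g \<Rightarrow> 'k) ring"
  have left_shift: "(\<Sum>h\<in>carrier G. F h) = (\<Sum>h\<in>carrier G. F (x \<otimes>\<^bsub>G\<^esub> h))"
    if "x \<in> carrier G" for x and F :: "'g \<Rightarrow> 'k"
    by (rule sum.reindex_bij_witness[of _ "\<lambda>h. x \<otimes>\<^bsub>G\<^esub> h" "\<lambda>h. inv\<^bsub>G\<^esub> x \<otimes>\<^bsub>G\<^esub> h"])
       (use that in \<open>auto simp: G.m_assoc[symmetric]\<close>)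
  have assoc: "(u \<otimes>\<^bsub>?R\<^esub> v) \<otimes>\<^bsub>?R\<^esub> w = u \<otimes>\<^bsub>?R\<^esub> (v \<otimes>\<^bsub>?R\<^esub> w)" for u v w :: "'g \<Rightarrow> 'k"
  proof
    fix g
    show "((u \<otimes>\<^bsub>?R\<^esub> v) \<otimes>\<^bsub>?R\<^esub> w) g = (u \<otimes>\<^bsub>?R\<^esub> (v \<otimes>\<^bsub>?R\<^esub> w)) g"
    proof (cases "g \<in> carrier G")
      case g: True
      have "((u \<otimes>\<^bsub>?R\<^esub> v) \<otimes>\<^bsub>?R\<^esub> w) g =
          (\<Sum>h\<in>carrier G. \<Sum>k\<in>carrier G. u k * (v (inv\<^bsub>G\<^esub> k \<otimes>\<^bsub>G\<^esub> h) * w (inv\<^bsub>G\<^esub> h \<otimes>\<^bsub>G\<^esub> g)))"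
        using g by (simp add: group_algebra_def sum_distrib_right mult.assoc)
      also have "\<dots> =
          (\<Sum>k\<in>carrier G. \<Sum>h\<in>carrier G. u k * (v (inv\<^bsub>G\<^esub> k \<otimes>\<^bsub>G\<^esub> h) * w (inv\<^bsub>G\<^esub> h \<otimes>\<^bsub>G\<^esub> g)))"
        by (rule sum.swap)
      also have "\<dots> =
          (\<Sum>k\<in>carrier G. \<Sum>h\<in>carrier G. u k * (v h * w (inv\<^bsub>G\<^esub> h \<otimes>\<^bsub>G\<^esub> (inv\<^bsub>G\<^esub> k \<otimes>\<^bsub>G\<^esub> g))))"
      proof (rule sum.cong[OF refl])
        fix k assume k: "k \<in> carrier G"
        show "(\<Sum>h\<in>carrier G. u k * (v (inv\<^bsub>G\<^esub> k \<otimes>\<^bsub>G\<^esub> h) * w (inv\<^bsub>G\<^esub> h \<otimes>\<^bsub>G\<^esub> g))) =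
            (\<Sum>h\<in>carrier G. u k * (v h * w (inv\<^bsub>G\<^esub> h \<otimes>\<^bsub>G\<^esub> (inv\<^bsub>G\<^esub> k \<otimes>\<^bsub>G\<^esub> g))))"
          by (subst left_shift[OF k], rule sum.cong)
             (use g k in \<open>auto simp: G.m_assoc[symmetric] G.inv_mult_group\<close>)
      qed
      also have "\<dots> = (u \<otimes>\<^bsub>?R\<^esub> (v \<otimes>\<^bsub>?R\<^esub> w)) g"
        using g by (simp add: group_algebra_def sum_distrib_left)
      finally show ?thesis .
    qed (simp add: group_algebra_def)
  qed
  have one_left: "\<one>\<^bsub>?R\<^esub> \<otimes>\<^bsub>?R\<^esub> u = u" if "u \<in> carrier ?R" for u
  proof
    fix g
    have "(\<Sum>h\<in>carrier G. (if h = \<one>\<^bsub>G\<^esub> then 1 else 0) * u (inv\<^bsub>G\<^esub> h \<otimes>\<^bsub>G\<^esub> g)) =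
        (\<Sum>h\<in>carrier G. if h = \<one>\<^bsub>G\<^esub> then u (inv\<^bsub>G\<^esub> h \<otimes>\<^bsub>G\<^esub> g) else 0)"
      by (intro sum.cong) auto
    then show "(\<one>\<^bsub>?R\<^esub> \<otimes>\<^bsub>?R\<^esub> u) g = u g"
      using that assms(2) by (auto simp: group_algebra_def)
  qed
  have one_right: "u \<otimes>\<^bsub>?R\<^esub> \<one>\<^bsub>?R\<^esub> = u" if "u \<in> carrier ?R" for u
  proof
    fix g
    have "(\<Sum>h\<in>carrier G. u h * (if inv\<^bsub>G\<^esub> h \<otimes>\<^bsub>G\<^esub> g = \<one>\<^bsub>G\<^esub> then 1 else 0)) =
        (\<Sum>h\<in>carrier G. if h = g then u h else 0)" if "g \<in> carrier G"
      using that by (intro sum.cong) (auto, metis G.inv_closed G.inv_equality G.inv_inv)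
    then show "(u \<otimes>\<^bsub>?R\<^esub> \<one>\<^bsub>?R\<^esub>) g = u g"
      using that assms(2) by (auto simp: group_algebra_def)
  qed
  show ?thesis
  proof (rule ringI)
    show "abelian_group ?R"
    proof (rule abelian_groupI)
      fix u assume "u \<in> carrier ?R"
      then show "\<exists>v\<in>carrier ?R. v \<oplus>\<^bsub>?R\<^esub> u = \<zero>\<^bsub>?R\<^esub>"
        by (intro bexI[of _ "\<lambda>g. - u g"]) (auto simp: group_algebra_def)
    qed (auto simp: group_algebra_def algebra_simps)
    show "monoid ?R"
      by (rule monoidI) (use assoc one_left one_right in \<open>auto simp: group_algebra_def\<close>)
  qed (auto simp: group_algebra_def algebra_simps sum.distrib)
qed

section \<open>The dihedral group\<close>

text \<open>The pair \<open>(e, i)\<close> with \<open>i < n\<close> stands for \<open>b\<^sup>e a\<^sup>i\<close> (\<open>e\<close> read as \<open>0\<close> or \<open>1\<close>), and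
  multiplication is \<open>b\<^sup>e a\<^sup>i b\<^sup>f a\<^sup>j = b\<^sup>e\<^sup>+\<^sup>f a\<^sup>\<plusminus>\<^sup>i\<^sup>+\<^sup>j\<close>, with the minus sign iff \<open>f = 1\<close>.\<close>

definition dihedral_group :: "nat \<Rightarrow> (bool \<times> nat) monoid" where
  "dihedral_group n =
    \<lparr> carrier = UNIV \<times> {..<n},
      monoid.mult = (\<lambda>(e, i) (f, j). (e \<noteq> f, ((if f then n - i else i) + j) mod n)),
      one = (False, 0) \<rparr>"

abbreviation dihedral_algebra :: "nat \<Rightarrow> (bool \<times> nat \<Rightarrow> 'k::field) ring" where
  "dihedral_algebra n \<equiv> group_algebra (dihedral_group n)"

lemma dihedral_group_is_group:
  assumes "n \<ge> 1"
  shows "group (dihedral_group n)"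
proof (rule groupI)
  fix x y z
  assume "x \<in> carrier (dihedral_group n)" "y \<in> carrier (dihedral_group n)"
    "z \<in> carrier (dihedral_group n)"
  then obtain e i f j g k where *: "x = (e, i)" "y = (f, j)" "z = (g, k)" "i < n" "j < n" "k < n"
    by (auto simp: dihedral_group_def)
  have "int ((if g then n - ((if f then n - i else i) + j) mod n
        else ((if f then n - i else i) + j) mod n) + k) mod int n =
      int ((if f \<noteq> g then n - i else i) + ((if g then n - j else j) + k) mod n) mod int n"
    using * by (auto simp: of_nat_mod of_nat_diff less_imp_le mod_simps algebra_simps)
      (auto simp: mod_eq_dvd_iff)
  then have "((if g then n - ((if f then n - i else i) + j) mod n
        else ((if f then n - i else i) + j) mod n) + k) mod n =
      ((if f \<noteq> g then n - i else i) + ((if g then n - j else j) + k) mod n) mod n"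
    by (simp only: of_nat_eq_iff flip: of_nat_mod)
  then show "x \<otimes>\<^bsub>dihedral_group n\<^esub> y \<otimes>\<^bsub>dihedral_group n\<^esub> z =
      x \<otimes>\<^bsub>dihedral_group n\<^esub> (y \<otimes>\<^bsub>dihedral_group n\<^esub> z)"
    using * by (auto simp: dihedral_group_def)
next
  fix x assume "x \<in> carrier (dihedral_group n)"
  then obtain e i where *: "x = (e, i)" "i < n"
    by (auto simp: dihedral_group_def)
  then show "\<exists>y\<in>carrier (dihedral_group n). y \<otimes>\<^bsub>dihedral_group n\<^esub> x = \<one>\<^bsub>dihedral_group n\<^esub>"
    by (intro bexI[of _ "(e, if e then i else (n - i) mod n)"])
       (auto simp: dihedral_group_def mod_simps)
qed (use assms in \<open>auto simp: dihedral_group_def\<close>)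

lemma dihedral_group_presentation:
  assumes "n \<ge> 2"
  defines "D \<equiv> dihedral_group n" and "a \<equiv> (False, 1)" and "b \<equiv> (True, 0)"
  shows "a \<in> carrier D" "b \<in> carrier D"
    "a [^]\<^bsub>D\<^esub> n = \<one>\<^bsub>D\<^esub>" "b [^]\<^bsub>D\<^esub> (2::nat) = \<one>\<^bsub>D\<^esub>"
    "b \<otimes>\<^bsub>D\<^esub> a \<otimes>\<^bsub>D\<^esub> b = inv\<^bsub>D\<^esub> a"
    "generate D {a, b} = carrier D" "card (carrier D) = 2 * n"
    "\<And>e i. i < n \<Longrightarrow> (e, i) = b [^]\<^bsub>D\<^esub> (of_bool e :: nat) \<otimes>\<^bsub>D\<^esub> a [^]\<^bsub>D\<^esub> i"
proof -
  interpret group D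
    unfolding D_def by (rule dihedral_group_is_group) (use assms in simp)
  show a: "a \<in> carrier D" and b: "b \<in> carrier D"
    using assms by (auto simp: dihedral_group_def)
  have pow_a: "a [^]\<^bsub>D\<^esub> i = (False, i mod n)" for i :: nat
    by (induction i) (use assms in \<open>auto simp: dihedral_group_def nat_pow_def mod_simps\<close>)
  show "a [^]\<^bsub>D\<^esub> n = \<one>\<^bsub>D\<^esub>"
    by (simp add: pow_a) (simp add: D_def dihedral_group_def)
  show "b [^]\<^bsub>D\<^esub> (2::nat) = \<one>\<^bsub>D\<^esub>"
    using b by (simp add: numeral_2_eq_2) (simp add: assms dihedral_group_def)
  have "(b \<otimes>\<^bsub>D\<^esub> a \<otimes>\<^bsub>D\<^esub> b) \<otimes>\<^bsub>D\<^esub> a = \<one>\<^bsub>D\<^esub>"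
    using assms by (simp add: dihedral_group_def)
  then show "b \<otimes>\<^bsub>D\<^esub> a \<otimes>\<^bsub>D\<^esub> b = inv\<^bsub>D\<^esub> a"
    using a b by (metis inv_equality m_closed)
  show "card (carrier D) = 2 * n"
    by (simp add: D_def dihedral_group_def card_cartesian_product)
  show normal_form: "(e, i) = b [^]\<^bsub>D\<^esub> (of_bool e :: nat) \<otimes>\<^bsub>D\<^esub> a [^]\<^bsub>D\<^esub> i" if "i < n" for e i
    using that b by (cases e) (simp_all add: pow_a, simp_all add: assms dihedral_group_def)
  have sub: "subgroup (generate D {a, b}) D"
    using a b by (intro generate_is_subgroup) auto
  have gen: "a \<in> generate D {a, b}" "b \<in> generate D {a, b}"
    by (auto intro: generate.incl)
  have pow: "x [^]\<^bsub>D\<^esub> k \<in> generate D {a, b}" if "x \<in> generate D {a, b}" for x and k :: nat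
    using that subgroup.m_closed[OF sub] subgroup.one_closed[OF sub]
    by (induction k) auto
  have "x \<in> generate D {a, b}" if "x \<in> carrier D" for x
  proof -
    obtain e i where "x = (e, i)"
      by (cases x)
    moreover from this have "i < n"
      using that by (auto simp: D_def dihedral_group_def)
    ultimately show ?thesis
      using normal_form[of i e] pow[OF gen(1)] pow[OF gen(2)] subgroup.m_closed[OF sub] by metis
  qed
  then show "generate D {a, b} = carrier D"
    using subgroup.subset[OF sub] by blast
qed

text \<open>The polynomials \<open>P\<close>, \<open>Q\<close> of degree less than \<open>n\<close> with \<open>u = P(a) + b Q(a)\<close>.\<close>

definition P_poly :: "nat \<Rightarrow> (bool \<times> nat \<Rightarrow> 'k::field) \<Rightarrow> 'k poly" where
  "P_poly n u = (\<Sum>i<n. Polynomial.monom (u (False, i)) i)"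

definition Q_poly :: "nat \<Rightarrow> (bool \<times> nat \<Rightarrow> 'k::field) \<Rightarrow> 'k poly" where
  "Q_poly n u = (\<Sum>i<n. Polynomial.monom (u (True, i)) i)"

section \<open>The factorization of $x^n - 1$\<close>

definition zeta :: "nat \<Rightarrow> nat" where
  "zeta n = (if odd n then 1 else 2)"

text \<open>The library's \<^const>\<open>reflect_poly\<close> is \<open>x\<^bsup>deg g\<^esup> g(x\<^sup>-\<^sup>1)\<close>.\<close>

definition monic_reflect :: "'k::field poly \<Rightarrow> 'k poly" where
  "monic_reflect g = Polynomial.smult (inverse (Polynomial.lead_coeff (reflect_poly g))) (reflect_poly g)"

definition ac_eval :: "'k::field poly \<Rightarrow> 'k alg_closure \<Rightarrow> 'k alg_closure" where
  "ac_eval g x = poly (map_poly to_ac g) x"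

definition irreducible_factors :: "nat \<Rightarrow> nat \<Rightarrow> (nat \<Rightarrow> 'k::field poly) \<Rightarrow> 'k poly list" where
  "irreducible_factors r s f =
    map f [1..<r + s + 1] @ map (\<lambda>j. monic_reflect (f j)) [r + 1..<r + s + 1]"

definition dihedral_factorization ::
  "nat \<Rightarrow> nat \<Rightarrow> nat \<Rightarrow> (nat \<Rightarrow> 'k::field poly) \<Rightarrow> bool" where
  "dihedral_factorization n r s f \<longleftrightarrow>
    Polynomial.monom 1 n - 1 =
      (\<Prod>j\<in>{1..r}. f j) * (\<Prod>j\<in>{r + 1..r + s}. f j * monic_reflect (f j)) \<and>
    (\<forall>g\<in>set (irreducible_factors r s f).
       Factorial_Ring.irreducible g \<and> Polynomial.lead_coeff g = 1) \<and>
    distinct (irreducible_factors r s f) \<and>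
    zeta n \<le> r \<and>
    f 1 = [:-1, 1:] \<and>
    (even n \<longrightarrow> f 2 = [:1, 1:]) \<and>
    (\<forall>j. 1 < j \<and> j \<le> r \<longrightarrow> reflect_poly (f j) = f j) \<and>
    (\<forall>j\<in>{r + 1..r + s}.
       {x. ac_eval (f j) x = 0} \<inter> {x. ac_eval (monic_reflect (f j)) x = 0} = {})"

section \<open>The component algebras and the decomposition map\<close>

abbreviation C2 :: "int monoid" where
  "C2 \<equiv> integer_mod_group 2"

text \<open>\<open>x + y h\<close> in the group algebra of \<open>C2\<close>, whose generator \<open>h\<close> is the residue \<open>1\<close>.\<close>

definition c2_elem :: "'k::field \<Rightarrow> 'k \<Rightarrow> int \<Rightarrow> 'k" where
  "c2_elem x y = (\<lambda>g. if g = 0 then x else if g = 1 then y else 0)"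

text \<open>The subring \<open>F\<^sub>q[\<beta>]\<close> of the algebraic closure.\<close>

definition adjoin :: "'k::field alg_closure \<Rightarrow> 'k alg_closure set" where
  "adjoin \<beta> = range (\<lambda>g. ac_eval g \<beta>)"

definition mat2_ring :: "'a::field set \<Rightarrow> ('a^2^2) ring" where
  "mat2_ring S =
    \<lparr> carrier = {M. \<forall>i j. M $ i $ j \<in> S}, monoid.mult = (**), one = mat 1,
      ring.zero = 0, add = (+) \<rparr>"

text \<open>The components \<open>A\<^sub>j\<close> are of two different kinds, so they are embedded in one type by
  \<^const>\<open>Inl\<close> (group algebras of \<open>C2\<close>) and \<^const>\<open>Inr\<close> (matrix algebras).\<close>

type_synonym 'k component = "(int \<Rightarrow> 'k) + 'k alg_closure^2^2"

definition component_algebra ::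
  "nat \<Rightarrow> nat \<Rightarrow> (nat \<Rightarrow> 'k::field alg_closure) \<Rightarrow> nat \<Rightarrow> 'k component ring" where
  "component_algebra n r \<alpha> j =
    (if j \<le> zeta n then image_ring Inl (group_algebra C2)
     else if j \<le> r then image_ring Inr (mat2_ring (adjoin (\<alpha> j + inverse (\<alpha> j))))
     else image_ring Inr (mat2_ring (adjoin (\<alpha> j))))"

text \<open>\<open>\<gamma>\<^sub>1\<close> is \<open>gamma_map n 1\<close> and \<open>\<gamma>\<^sub>2\<close> is \<open>gamma_map n (-1)\<close>.\<close>

definition gamma_map :: "nat \<Rightarrow> 'k::field \<Rightarrow> (bool \<times> nat \<Rightarrow> 'k) \<Rightarrow> int \<Rightarrow> 'k" where
  "gamma_map n c u = c2_elem (poly (P_poly n u) c) (poly (Q_poly n u) c)"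

definition tau_map ::
  "nat \<Rightarrow> 'k::field alg_closure \<Rightarrow> (bool \<times> nat \<Rightarrow> 'k) \<Rightarrow> 'k alg_closure^2^2" where
  "tau_map n x u = vector
    [vector [ac_eval (P_poly n u) x, ac_eval (Q_poly n u) (inverse x)],
     vector [ac_eval (Q_poly n u) x, ac_eval (P_poly n u) (inverse x)]]"

definition Z_mat :: "'a::field \<Rightarrow> 'a^2^2" where
  "Z_mat x = vector [vector [1, - x], vector [1, - inverse x]]"

definition sigma_map :: "'a::field \<Rightarrow> 'a^2^2 \<Rightarrow> 'a^2^2" where
  "sigma_map x M = matrix_inv (Z_mat x) ** M ** Z_mat x"

definition component_map ::
  "nat \<Rightarrow> nat \<Rightarrow> (nat \<Rightarrow> 'k::field alg_closure) \<Rightarrow> nat \<Rightarrow> (bool \<times> nat \<Rightarrow> 'k) \<Rightarrow> 'k component"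
  where
  "component_map n r \<alpha> j u =
    (if j \<le> zeta n then Inl (gamma_map n (if j = 1 then 1 else - 1) u)
     else if j \<le> r then Inr (sigma_map (\<alpha> j) (tau_map n (\<alpha> j) u))
     else Inr (tau_map n (\<alpha> j) u))"

text \<open>The direct sum of the \<open>A\<^sub>j\<close> (and likewise of left ideals \<open>B\<^sub>j\<close>) is the set of families
  indexed by \<open>{1..r + s}\<close>, that is, a \<^const>\<open>PiE\<close>.\<close>

definition decomposition_map ::
  "nat \<Rightarrow> nat \<Rightarrow> nat \<Rightarrow> (nat \<Rightarrow> 'k::field alg_closure) \<Rightarrow> (bool \<times> nat \<Rightarrow> 'k) \<Rightarrow> nat \<Rightarrow> 'k component"
  where
  "decomposition_map n r s \<alpha> u = (\<lambda>j\<in>{1..r + s}. component_map n r \<alpha> j u)"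

end

theory Submission
  imports Defs
begin

text \<open>
  Write \<open>c \<mapsto> c'\<close> for the linear extension of \<open>g \<mapsto> g\<^sup>-\<^sup>1\<close> to the group algebra.  The dot product of
  \<open>g c\<close> and \<open>x\<close> is the coefficient of \<open>x c'\<close> at \<open>g\<close>, so for a left ideal \<open>I\<close> a vector
  \<open>x\<close> lies in \<open>I\<^sup>\<bottom>\<close> iff \<open>x c' = 0\<close> for all \<open>c \<in> I\<close> (\<open>dual_code_left_ideal\<close>).  Thus a metric
  condition becomes an algebraic one, and the algebraic one can be tested in each component.

  The matrices \<open>\<tau>\<^sub>j\<close> are the linear extensions of representations of \<open>D\<^sub>n\<close> whose values have
  determinant \<open>\<plusminus>1\<close>.  In characteristic 2 the determinant is 1, and the inverse of a
  \<open>2 \<times> 2\<close> matrix of determinant 1 is its adjugate, which is linear in the matrix.  Hence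
  \<open>\<tau>\<^sub>j(c') = adj(\<tau>\<^sub>j(c))\<close>, and \<open>I\<^sup>\<bottom>\<close> corresponds in every component to the annihilator
  \<open>{M. M adj(N) = 0 for all N \<in> B\<^sub>j}\<close>.

  In the matrix algebra \<open>M\<^sub>2(K)\<close> the entries of \<open>M adj(N)\<close> are, up to sign, the determinants whose
  rows are a row of \<open>M\<close> and a row of \<open>N\<close>.  A proper nonzero left ideal consists of all matrices whose rows lie on
  one line, so it is its own annihilator (\<open>mat2_proper_left_ideal_eq_annihilator\<close>).  The
  algebra of the group of order 2 is local in characteristic 2, its only proper nonzero
  ideal is spanned by \<open>1 + h\<close>, and \<open>(1 + h)\<^sup>2 = 0\<close>, which gives the same statement
  (\<open>C2_proper_left_ideal_eq_annihilator\<close>).  So \<open>I\<close> is self-dual if all \<open>B\<^sub>j\<close> are proper and nonzero.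

  Conversely, let \<open>I\<close> be self-dual.  If \<open>B\<^sub>j = A\<^sub>j\<close>, then some \<open>c \<in> I\<close> has the component
  \<open>1\<close> at \<open>j\<close> and is not orthogonal to itself.  If \<open>B\<^sub>j = 0\<close>, then
  \<open>u = (x\<^sup>n - 1)/f\<^sub>j\<close>, evaluated at \<open>a\<close>, is nonzero only in the component \<open>j\<close>, where \<open>I\<close>
  vanishes.  Hence \<open>u\<close> is orthogonal to \<open>I\<close> and so in \<open>I\<close>, although its component at \<open>j\<close> is not in \<open>B\<^sub>j\<close>.

  The decomposition map is injective for the following reason: an element of the kernel consists of polynomials \<open>P\<close>, \<open>Q\<close> of degree less than \<open>n\<close> that vanish at all
  \<open>\<alpha>\<^sub>j\<close> and \<open>\<alpha>\<^sub>j\<^sup>-\<^sup>1\<close>; they are divisible by every irreducible factor of \<open>x\<^sup>n - 1\<close>, thus by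
  \<open>x\<^sup>n - 1\<close>, and vanish (\<open>poly_eq_0_if_vanishes\<close>).
\<close>

section \<open>Evaluation at elements of the algebraic closure\<close>

lemma ac_eval_simps [simp]:
  "ac_eval 0 x = 0" "ac_eval 1 x = 1"
  "ac_eval (pCons a p) x = to_ac a + x * ac_eval p x"
  "ac_eval (Polynomial.monom a k) x = to_ac a * x ^ k"
  by (simp_all add: ac_eval_def map_poly_pCons map_poly_monom poly_monom)

lemma ac_eval_add [simp]: "ac_eval (p + q) x = ac_eval p x + ac_eval q x"
proof -
  have "map_poly to_ac (p + q) = map_poly to_ac p + map_poly to_ac q"
    by (rule poly_eqI) (simp add: coeff_map_poly)
  then show ?thesis by (simp add: ac_eval_def)
qed

lemma ac_eval_uminus [simp]: "ac_eval (- p) x = - ac_eval p x"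
  using ac_eval_add[of p "- p" x] by (simp add: eq_neg_iff_add_eq_0 add.commute)

lemma ac_eval_diff [simp]: "ac_eval (p - q) x = ac_eval p x - ac_eval q x"
  using ac_eval_add[of p "- q" x] by simp

lemma ac_eval_smult [simp]: "ac_eval (Polynomial.smult c p) x = to_ac c * ac_eval p x"
  by (induction p) (simp_all add: algebra_simps)

lemma ac_eval_mult [simp]: "ac_eval (p * q) x = ac_eval p x * ac_eval q x"
  by (induction p) (simp_all add: algebra_simps)

lemma ac_eval_sum: "ac_eval (\<Sum>i\<in>A. p i) x = (\<Sum>i\<in>A. ac_eval (p i) x)"
  by (induction A rule: infinite_finite_induct) simp_all

lemma ac_eval_to_ac: "ac_eval p (to_ac c) = to_ac (poly p c)"
  by (induction p) simp_all

lemma ac_eval_reflect_poly: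
  assumes "x \<noteq> 0"
  shows "ac_eval (reflect_poly p) x = x ^ Polynomial.degree p * ac_eval p (inverse x)"
proof -
  have deg: "Polynomial.degree (map_poly to_ac p) = Polynomial.degree p"
    by (rule degree_map_poly) auto
  have "map_poly to_ac (reflect_poly p) = reflect_poly (map_poly to_ac p)"
    by (rule poly_eqI) (simp add: coeff_map_poly coeff_reflect_poly deg)
  then show ?thesis
    using poly_reflect_poly_nz[OF assms, of "map_poly to_ac p"] by (simp add: ac_eval_def deg)
qed

text \<open>An irreducible polynomial with the root \<open>x\<close> is a minimal polynomial of \<open>x\<close> up to a unit.\<close>

lemma irreducible_dvd_if_common_root:
  fixes p g :: "'k::field poly"
  assumes "Factorial_Ring.irreducible g" "ac_eval g x = 0" "ac_eval p x = 0"
  shows "g dvd p"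
proof -
  define V where "V = (\<lambda>m :: 'k poly. m \<noteq> 0 \<and> ac_eval m x = 0)"
  have "V g" using assms by (auto simp: V_def)
  \<comment> \<open>\<open>m\<close> is a minimal polynomial of \<open>x\<close>; division with remainder shows that it divides both.\<close>
  define m where "m = arg_min Polynomial.degree V"
  have m: "V m" "\<And>m'. V m' \<Longrightarrow> Polynomial.degree m \<le> Polynomial.degree m'"
    unfolding m_def using \<open>V g\<close> by (auto intro: arg_min_natI arg_min_nat_le)
  have m_dvd: "m dvd h" if h: "ac_eval h x = 0" for h
  proof -
    have "ac_eval h x = ac_eval m x * ac_eval (h div m) x + ac_eval (h mod m) x"
      by (metis ac_eval_add ac_eval_mult mult_div_mod_eq)
    then have "ac_eval (h mod m) x = 0" using m(1) h by (simp add: V_def)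
    moreover have "h mod m = 0 \<or> Polynomial.degree (h mod m) < Polynomial.degree m"
      using m(1) degree_mod_less[of m h] by (auto simp: V_def)
    ultimately have "h mod m = 0" using m(2)[of "h mod m"] unfolding V_def by linarith
    then show ?thesis by auto
  qed
  obtain h where h: "g = m * h" using m_dvd[OF assms(2)] by (auto elim: dvdE)
  have "\<not> m dvd 1"
  proof
    assume "m dvd 1"
    then obtain l where "1 = m * l" by (auto elim: dvdE)
    then have "ac_eval 1 x = ac_eval m x * ac_eval l x" by (metis ac_eval_mult)
    then show False using m(1) by (simp add: V_def)
  qed
  then have "h dvd 1" using assms(1) h by (auto dest: irreducibleD)
  then have "g dvd m" using h by (metis dvd_refl mult.right_neutral mult_dvd_mono)
  then show ?thesis using m_dvd[OF assms(3)] by (rule dvd_trans)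
qed

lemma monic_irreducible_eqI:
  fixes g h :: "'k::field poly"
  assumes "Factorial_Ring.irreducible g" "Factorial_Ring.irreducible h"
    and "Polynomial.lead_coeff g = 1" "Polynomial.lead_coeff h = 1"
    and "g dvd h"
  shows "g = h"
proof -
  obtain c where c: "h = g * c" using assms(5) by (auto elim: dvdE)
  have "\<not> g dvd 1" using assms(1) by (simp add: Factorial_Ring.irreducible_def)
  then have "c dvd 1" using assms(2) c by (auto dest: irreducibleD)
  then obtain a where a: "c = [:a:]" by (auto simp: is_unit_poly_iff)
  have "Polynomial.lead_coeff h = Polynomial.lead_coeff g * Polynomial.lead_coeff c"
    by (simp only: c lead_coeff_mult)
  then show ?thesis using assms(3,4) a c by (simp split: if_splits)
qed

lemma distinct_irreducibles_prod_dvd: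
  fixes gs :: "'k::field poly list"
  assumes "distinct gs"
    and "\<And>g. g \<in> set gs \<Longrightarrow> Factorial_Ring.irreducible g \<and> Polynomial.lead_coeff g = 1"
    and "\<And>g. g \<in> set gs \<Longrightarrow> g dvd p"
  shows "prod_list gs dvd p"
  using assms
proof (induction gs)
  case (Cons g gs)
  then obtain h where h: "p = prod_list gs * h" by (auto elim: dvdE)
  have prime: "prime_elem g"
    using Cons.prems(2)[of g] by (intro field_poly_irreducible_imp_prime) simp
  have "\<not> g dvd prod_list gs"
  proof
    assume "g dvd prod_list gs"
    then obtain h where "h \<in> set gs" "g dvd h"
      using prime by (induction gs) (auto simp: prime_elem_dvd_mult_iff)
    then have "g = h"
      using Cons.prems(2) monic_irreducible_eqI[of g h] by simp
    then show False using Cons.prems(1) \<open>h \<in> set gs\<close> by simp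
  qed
  then have "g dvd h"
    using Cons.prems(3)[of g] h prime by (auto simp: prime_elem_dvd_mult_iff)
  then show ?case using h by (simp add: mult.commute mult_dvd_mono)
qed simp

text \<open>An even number of elements forces characteristic 2: negation permutes the odd number
  \<open>q - 1\<close> of nonzero elements, so comparing their product before and after gives \<open>(-1)\<^bsup>q - 1\<^esup> = 1\<close>,
  that is, \<open>-1 = 1\<close>.\<close>

lemma uminus_eq_if_even_card:
  fixes x :: "'k::{field,finite}"
  assumes "even CARD('k)"
  shows "- x = x"
proof -
  let ?U = "UNIV - {0 :: 'k}"
  have "(\<Prod>y\<in>?U. y) = (\<Prod>y\<in>?U. - y)"
    by (rule prod.reindex_bij_witness[of _ uminus uminus]) auto
  also have "\<dots> = (- 1) ^ card ?U * (\<Prod>y\<in>?U. y)"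
    by (simp add: prod_uminus)
  finally have "(- 1 :: 'k) ^ card ?U = 1" by simp
  moreover have "odd (card ?U)"
    using assms by (simp add: card_Diff_singleton)
  ultimately have "(- 1 :: 'k) = 1" by simp
  then show ?thesis by (metis mult_minus1 mult_1)
qed

section \<open>Extension fields generated by algebraic elements\<close>

lemma adjoin_closed:
  "0 \<in> adjoin \<beta>" "1 \<in> adjoin \<beta>" "to_ac c \<in> adjoin \<beta>" "\<beta> \<in> adjoin \<beta>"
  "x \<in> adjoin \<beta> \<Longrightarrow> y \<in> adjoin \<beta> \<Longrightarrow> x + y \<in> adjoin \<beta>"
  "x \<in> adjoin \<beta> \<Longrightarrow> y \<in> adjoin \<beta> \<Longrightarrow> x - y \<in> adjoin \<beta>"
  "x \<in> adjoin \<beta> \<Longrightarrow> y \<in> adjoin \<beta> \<Longrightarrow> x * y \<in> adjoin \<beta>"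
  "x \<in> adjoin \<beta> \<Longrightarrow> - x \<in> adjoin \<beta>"
proof -
  have "ac_eval p \<beta> \<in> adjoin \<beta>" for p by (simp add: adjoin_def)
  from this[of 0] this[of 1] this[of "[:c:]"] this[of "[:0, 1:]"]
  show "0 \<in> adjoin \<beta>" "1 \<in> adjoin \<beta>" "to_ac c \<in> adjoin \<beta>" "\<beta> \<in> adjoin \<beta>"
    by simp_all
  show "x + y \<in> adjoin \<beta>" "x - y \<in> adjoin \<beta>" "x * y \<in> adjoin \<beta>"
    if "x \<in> adjoin \<beta>" "y \<in> adjoin \<beta>" for x y
    using that unfolding adjoin_def
    by (auto, (metis ac_eval_add ac_eval_diff ac_eval_mult rangeI)+)
  show "- x \<in> adjoin \<beta>" if "x \<in> adjoin \<beta>" for x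
    using that unfolding adjoin_def by (auto, metis ac_eval_uminus rangeI)
qed

lemma adjoin_ac_eval_closed: "x \<in> adjoin \<beta> \<Longrightarrow> ac_eval p x \<in> adjoin \<beta>"
  by (induction p) (auto intro: adjoin_closed)

text \<open>A ring between the base field and its algebraic closure is a field: dividing
  an algebraic equation \<open>p(x) = 0\<close> with nonzero constant term \<open>a\<close> by \<open>a x\<close> expresses
  \<open>x\<^sup>-\<^sup>1\<close> as a polynomial in \<open>x\<close>.\<close>

lemma adjoin_inverse_closed:
  fixes x :: "'k::field alg_closure"
  assumes x: "x \<in> adjoin \<beta>"
  shows "inverse x \<in> adjoin \<beta>"
proof (cases "x = 0")
  case False
  obtain p :: "'k poly" where "p \<noteq> 0" "ac_eval p x = 0"
    using alg_closure_algebraic[of x] by (auto simp: ac_eval_def)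
  then show ?thesis
  proof (induction p)
    case (pCons a p)
    show ?case
    proof (cases "a = 0")
      case True
      then show ?thesis using pCons False by auto
    next
      case a: False
      have "x * ac_eval p x = - to_ac a"
        using pCons.prems by (simp add: eq_neg_iff_add_eq_0 add.commute)
      then have "inverse x = - ac_eval p x * to_ac (inverse a)"
        using a False by (simp add: field_simps)
      then show ?thesis
        using x by (auto intro: adjoin_closed adjoin_ac_eval_closed simp del: to_ac_inverse)
    qed
  qed simp
qed (auto intro: adjoin_closed)

text \<open>The quotients \<open>(x\<^sup>k - x\<^sup>-\<^sup>k)/(x - x\<^sup>-\<^sup>1)\<close> are Chebyshev polynomials of the second kind in
  \<open>t = x + x\<^sup>-\<^sup>1\<close>: they satisfy \<open>U\<^sub>k\<^sub>+\<^sub>2 = t U\<^sub>k\<^sub>+\<^sub>1 - U\<^sub>k\<close>.  This is why conjugation by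
  \<open>Z\<^sub>j\<close> moves the entries of \<open>\<tau>\<^sub>j\<close> into the smaller field.\<close>

lemma difference_quotient_in_adjoin:
  fixes x :: "'k::field alg_closure"
  assumes "x \<noteq> 0" "x \<noteq> inverse x"
  shows "(ac_eval p x - ac_eval p (inverse x)) / (x - inverse x) \<in> adjoin (x + inverse x)"
proof -
  let ?y = "inverse x"
  define D where "D = (\<lambda>p. (ac_eval p x - ac_eval p ?y) / (x - ?y))"
  let ?S = "adjoin (x + ?y)"
  \<comment> \<open>The recursion has two terms, so the induction carries \<open>p\<close> together with \<open>x p\<close>.\<close>
  have "D p \<in> ?S \<and> D (pCons 0 p) \<in> ?S"
  proof (induction p)
    case (pCons a p)
    have "D (pCons a p) = D (pCons 0 p)" by (simp add: D_def)
    moreover have "D (pCons 0 (pCons a p)) = to_ac a + ((x + ?y) * D (pCons 0 p) - D p)"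
    proof -
      have telescope: "x * (c + x * u) - y * (c + y * v) =
          c * (x - y) + (x + y) * (x * u - y * v) - (u - v)" if "x * y = 1" for c u v y
      proof -
        have "x * (c + x * u) - y * (c + y * v) - (c * (x - y) + (x + y) * (x * u - y * v) - (u - v)) =
            (1 - x * y) * (u - v)"
          by (simp add: algebra_simps)
        then show ?thesis using that by simp
      qed
      have split: "(c * d + e * N - M) / d = c + (e * (N / d) - M / d)"
        if "d \<noteq> 0" for c d e M N :: "'k alg_closure"
        using that by (simp add: field_simps)
      have nonzero: "x - ?y \<noteq> 0" and inverse: "x * ?y = 1" using assms by simp_all
      show ?thesis
        unfolding D_def ac_eval_simps to_ac_0 add_0 telescope[OF inverse]
        by (rule split[OF nonzero])
    qed
    ultimately show ?case using pCons.IH by (auto intro!: adjoin_closed)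
  qed (simp add: D_def adjoin_closed)
  then show ?thesis by (simp add: D_def)
qed

section \<open>Duals of left ideals in group algebras\<close>

definition antipode :: "('g, 'm) monoid_scheme \<Rightarrow> ('g \<Rightarrow> 'k::field) \<Rightarrow> 'g \<Rightarrow> 'k" where
  "antipode G u = (\<lambda>g. if g \<in> carrier G then u (inv\<^bsub>G\<^esub> g) else 0)"

text \<open>The coefficient of \<open>x c'\<close> at \<open>g\<close>, with \<open>c'\<close> the antipode of \<open>c\<close>, is
  the dot product of \<open>g c\<close> and \<open>x\<close>, and a left ideal contains \<open>g c\<close> together with \<open>c\<close>.\<close>

lemma dual_code_left_ideal:
  fixes I :: "('g \<Rightarrow> 'k::field) set"
  assumes "group G" "finite (carrier G)" "left_ideal I (group_algebra G)"
  shows "x \<in> dual_code G I \<longleftrightarrow>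
    x \<in> carrier (group_algebra G) \<and>
    (\<forall>c\<in>I. x \<otimes>\<^bsub>group_algebra G\<^esub> antipode G c = \<zero>\<^bsub>group_algebra G\<^esub>)"
proof -
  interpret G: group G by fact
  \<comment> \<open>The translate \<open>g c\<close>.\<close>
  define shift where "shift = (\<lambda>g (c :: 'g \<Rightarrow> 'k) h. if h \<in> carrier G then c (inv\<^bsub>G\<^esub> g \<otimes>\<^bsub>G\<^esub> h) else 0)"
  have conv: "(x \<otimes>\<^bsub>group_algebra G\<^esub> antipode G c) g = dot_product G (shift g c) x"
    if "g \<in> carrier G" for g c
    using that
    by (auto simp: group_algebra_def antipode_def shift_def dot_product_def G.inv_mult_group
        mult.commute intro!: sum.cong)
  have shift_mem: "shift g c \<in> I" if "g \<in> carrier G" "c \<in> I" for g c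
  proof -
    define \<delta> where "\<delta> = (\<lambda>h. if h = g then 1 else 0 :: 'k)"
    have "\<delta> \<otimes>\<^bsub>group_algebra G\<^esub> c = shift g c"
    proof
      fix h
      have "(\<Sum>k\<in>carrier G. \<delta> k * c (inv\<^bsub>G\<^esub> k \<otimes>\<^bsub>G\<^esub> h)) =
          (\<Sum>k\<in>carrier G. if k = g then c (inv\<^bsub>G\<^esub> k \<otimes>\<^bsub>G\<^esub> h) else 0)"
        by (intro sum.cong) (auto simp: \<delta>_def)
      then show "(\<delta> \<otimes>\<^bsub>group_algebra G\<^esub> c) h = shift g c h"
        using that assms(2) by (simp add: group_algebra_def shift_def)
    qed
    moreover have "\<delta> \<in> carrier (group_algebra G)"
      using that by (auto simp: group_algebra_def \<delta>_def)
    ultimately show ?thesis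
      using assms(3) that(2) by (metis left_ideal_def)
  qed
  have sub: "I \<subseteq> carrier (group_algebra G)"
    using assms(3) by (auto simp: left_ideal_def dest: additive_subgroup.a_Hcarr)
  have shift_one: "shift \<one>\<^bsub>G\<^esub> c = c" if "c \<in> I" for c
    using sub that by (fastforce simp: shift_def group_algebra_def)
  have "(\<forall>c\<in>I. dot_product G c x = 0) \<longleftrightarrow>
      (\<forall>c\<in>I. \<forall>g\<in>carrier G. dot_product G (shift g c) x = 0)"
    using shift_mem shift_one by (metis G.one_closed)
  also have "\<dots> \<longleftrightarrow>
      (\<forall>c\<in>I. x \<otimes>\<^bsub>group_algebra G\<^esub> antipode G c = \<zero>\<^bsub>group_algebra G\<^esub>)"
  proof -
    have "x \<otimes>\<^bsub>group_algebra G\<^esub> antipode G c = \<zero>\<^bsub>group_algebra G\<^esub> \<longleftrightarrow>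
        (\<forall>g\<in>carrier G. (x \<otimes>\<^bsub>group_algebra G\<^esub> antipode G c) g = 0)" for c
      by (auto simp: group_algebra_def fun_eq_iff)
    then show ?thesis by (simp add: conv)
  qed
  finally show ?thesis by (simp add: dual_code_def)
qed

definition linear_extension ::
  "('g, 'm) monoid_scheme \<Rightarrow> ('g \<Rightarrow> 'k::field alg_closure^'n^'n) \<Rightarrow> ('g \<Rightarrow> 'k) \<Rightarrow> 'k alg_closure^'n^'n"
  where "linear_extension G \<rho> u = (\<chi> i j. \<Sum>g\<in>carrier G. to_ac (u g) * \<rho> g $ i $ j)"

lemma linear_extension_mult:
  assumes "group G" "finite (carrier G)"
    and hom: "\<And>g h. g \<in> carrier G \<Longrightarrow> h \<in> carrier G \<Longrightarrow> \<rho> (g \<otimes>\<^bsub>G\<^esub> h) = \<rho> g ** \<rho> h"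
  shows "linear_extension G \<rho> (u \<otimes>\<^bsub>group_algebra G\<^esub> v) =
    linear_extension G \<rho> u ** linear_extension G \<rho> v"
proof -
  interpret G: group G by fact
  let ?C = "carrier G"
  have "(\<Sum>g\<in>?C. to_ac (\<Sum>h\<in>?C. u h * v (inv\<^bsub>G\<^esub> h \<otimes>\<^bsub>G\<^esub> g)) * \<rho> g $ i $ j) =
      (\<Sum>k\<in>UNIV. (\<Sum>h\<in>?C. to_ac (u h) * \<rho> h $ i $ k) * (\<Sum>g\<in>?C. to_ac (v g) * \<rho> g $ k $ j))"
    for i j
  proof -
    have "(\<Sum>g\<in>?C. to_ac (\<Sum>h\<in>?C. u h * v (inv\<^bsub>G\<^esub> h \<otimes>\<^bsub>G\<^esub> g)) * \<rho> g $ i $ j) =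
        (\<Sum>h\<in>?C. \<Sum>g\<in>?C. to_ac (u h) * to_ac (v (inv\<^bsub>G\<^esub> h \<otimes>\<^bsub>G\<^esub> g)) * \<rho> g $ i $ j)"
      by (simp add: to_ac_sum sum_distrib_right) (rule sum.swap)
    also have "\<dots> = (\<Sum>h\<in>?C. \<Sum>g\<in>?C. to_ac (u h) * to_ac (v g) * \<rho> (h \<otimes>\<^bsub>G\<^esub> g) $ i $ j)"
    proof (rule sum.cong[OF refl])
      fix h assume h: "h \<in> ?C"
      show "(\<Sum>g\<in>?C. to_ac (u h) * to_ac (v (inv\<^bsub>G\<^esub> h \<otimes>\<^bsub>G\<^esub> g)) * \<rho> g $ i $ j) =
          (\<Sum>g\<in>?C. to_ac (u h) * to_ac (v g) * \<rho> (h \<otimes>\<^bsub>G\<^esub> g) $ i $ j)"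
        by (rule sum.reindex_bij_witness[of _ "\<lambda>g. h \<otimes>\<^bsub>G\<^esub> g" "\<lambda>g. inv\<^bsub>G\<^esub> h \<otimes>\<^bsub>G\<^esub> g"])
           (use h in \<open>auto simp: G.m_assoc[symmetric]\<close>)
    qed
    also have "\<dots> = (\<Sum>h\<in>?C. \<Sum>g\<in>?C. \<Sum>k\<in>UNIV.
        (to_ac (u h) * \<rho> h $ i $ k) * (to_ac (v g) * \<rho> g $ k $ j))"
      by (intro sum.cong) (simp_all add: hom matrix_matrix_mult_def sum_distrib_left mult_ac)
    also have "\<dots> = (\<Sum>h\<in>?C. \<Sum>k\<in>UNIV. \<Sum>g\<in>?C.
        (to_ac (u h) * \<rho> h $ i $ k) * (to_ac (v g) * \<rho> g $ k $ j))"
      by (intro sum.cong refl sum.swap)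
    also have "\<dots> = (\<Sum>k\<in>UNIV. \<Sum>h\<in>?C. \<Sum>g\<in>?C.
        (to_ac (u h) * \<rho> h $ i $ k) * (to_ac (v g) * \<rho> g $ k $ j))"
      by (rule sum.swap)
    finally show ?thesis by (simp add: sum_product)
  qed
  then show ?thesis
    by (simp add: linear_extension_def vec_eq_iff matrix_matrix_mult_def group_algebra_def)
qed

lemma linear_extension_antipode:
  assumes "group G" "finite (carrier G)"
  shows "linear_extension G \<rho> (antipode G u) = linear_extension G (\<lambda>g. \<rho> (inv\<^bsub>G\<^esub> g)) u"
proof -
  interpret G: group G by fact
  have "(\<Sum>g\<in>carrier G. to_ac (antipode G u g) * \<rho> g $ i $ j) =
      (\<Sum>g\<in>carrier G. to_ac (u g) * \<rho> (inv\<^bsub>G\<^esub> g) $ i $ j)" for i j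
    by (rule sum.reindex_bij_witness[of _ "\<lambda>g. inv\<^bsub>G\<^esub> g" "\<lambda>g. inv\<^bsub>G\<^esub> g"])
       (auto simp: antipode_def)
  then show ?thesis by (simp add: linear_extension_def)
qed

section \<open>Two-dimensional representations of the dihedral group\<close>

text \<open>The coefficients of formal power series share the symbol of the vector entries.\<close>

no_notation fps_nth (infixl "$" 75)

abbreviation mat22 :: "'a::zero \<Rightarrow> 'a \<Rightarrow> 'a \<Rightarrow> 'a \<Rightarrow> 'a^2^2" where
  "mat22 a b c d \<equiv> vector [vector [a, b], vector [c, d]]"

definition adjugate2 :: "'a::comm_ring_1^2^2 \<Rightarrow> 'a^2^2" where
  "adjugate2 M = mat22 (M$2$2) (- M$1$2) (- M$2$1) (M$1$1)"

lemmas mat2_simps =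
  vec_eq_iff forall_2 matrix_matrix_mult_def sum_2 mat_def adjugate2_def

definition dihedral_rep :: "'a::field \<Rightarrow> bool \<times> nat \<Rightarrow> 'a^2^2" where
  "dihedral_rep \<omega> = (\<lambda>(e, i).
    if e then mat22 0 (inverse \<omega> ^ i) (\<omega> ^ i) 0
    else mat22 (\<omega> ^ i) 0 0 (inverse \<omega> ^ i))"

lemma power_mod_of_root_of_unity:
  fixes x :: "'a::monoid_mult"
  assumes "x ^ n = 1"
  shows "x ^ (i mod n) = x ^ i"
proof -
  have "x ^ i = x ^ (n * (i div n) + i mod n)" by simp
  also have "\<dots> = x ^ (i mod n)" by (simp only: power_add power_mult assms power_one mult_1)
  finally show ?thesis by simp
qed

lemma power_diff_of_root_of_unity:
  fixes x :: "'a::field"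
  assumes "x ^ n = 1" "i \<le> n"
  shows "x ^ (n - i) = inverse x ^ i"
proof -
  have "x ^ (n - i) * x ^ i = 1" using assms by (simp flip: power_add)
  then show ?thesis by (metis inverse_unique mult.commute power_inverse)
qed

lemma dihedral_rep_mult:
  assumes "\<omega> ^ n = 1"
    and "g \<in> carrier (dihedral_group n)" "h \<in> carrier (dihedral_group n)"
  shows "dihedral_rep \<omega> (g \<otimes>\<^bsub>dihedral_group n\<^esub> h) = dihedral_rep \<omega> g ** dihedral_rep \<omega> h"
proof -
  obtain e i f j where *: "g = (e, i)" "h = (f, j)" "i < n" "j < n"
    using assms by (auto simp: dihedral_group_def)
  have "inverse \<omega> ^ n = 1" using assms(1) by (simp add: power_inverse)
  note mod = power_mod_of_root_of_unity[OF assms(1)] power_mod_of_root_of_unity[OF this]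
  note diff = power_diff_of_root_of_unity[OF assms(1), of i]
    power_diff_of_root_of_unity[OF \<open>inverse \<omega> ^ n = 1\<close>, of i]
  show ?thesis
    using * diff
    by (auto simp: dihedral_group_def dihedral_rep_def mat2_simps mod power_add mult.commute)
qed

lemma dihedral_group_inv:
  assumes "i < n"
  shows "inv\<^bsub>dihedral_group n\<^esub> (e, i) = (e, if e then i else (n - i) mod n)"
proof -
  interpret group "dihedral_group n" by (rule dihedral_group_is_group) (use assms in simp)
  show ?thesis
    by (rule inv_equality) (use assms in \<open>auto simp: dihedral_group_def mod_simps\<close>)
qed

text \<open>The matrices have determinant \<open>\<plusminus>1\<close>, and the sign disappears in characteristic 2.\<close>

lemma dihedral_rep_inv:
  fixes \<omega> :: "'a::field"
  assumes "\<omega> ^ n = 1" "g \<in> carrier (dihedral_group n)" and char2: "\<And>x :: 'a. - x = x"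
  shows "dihedral_rep \<omega> (inv\<^bsub>dihedral_group n\<^esub> g) = adjugate2 (dihedral_rep \<omega> g)"
proof -
  obtain e i where *: "g = (e, i)" "i < n"
    using assms by (auto simp: dihedral_group_def)
  have "inverse \<omega> ^ n = 1" using assms(1) by (simp add: power_inverse)
  note mod = power_mod_of_root_of_unity[OF assms(1)] power_mod_of_root_of_unity[OF this]
  note diff = power_diff_of_root_of_unity[OF assms(1), of i]
    power_diff_of_root_of_unity[OF \<open>inverse \<omega> ^ n = 1\<close>, of i]
  show ?thesis
    using * diff
    by (auto simp: dihedral_group_inv dihedral_rep_def mat2_simps mod char2)
qed

lemma adjugate2_linear_extension:
  "adjugate2 (linear_extension G \<rho> u) = linear_extension G (\<lambda>g. adjugate2 (\<rho> g)) u"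
  by (simp add: linear_extension_def adjugate2_def vec_eq_iff forall_2 sum_negf)

lemma tau_map_eq_linear_extension:
  "tau_map n \<omega> u = linear_extension (dihedral_group n) (dihedral_rep \<omega>) u"
proof -
  have sum: "(\<Sum>g\<in>carrier (dihedral_group n). F g) = (\<Sum>i<n. F (False, i)) + (\<Sum>i<n. F (True, i))"
    for F :: "bool \<times> nat \<Rightarrow> 'a alg_closure"
    using sum.cartesian_product[of "\<lambda>e i. F (e, i)" "{..<n}" UNIV]
    by (simp add: dihedral_group_def UNIV_bool)
  show ?thesis
    by (simp add: tau_map_def linear_extension_def vec_eq_iff forall_2 sum P_poly_def Q_poly_def
        ac_eval_sum dihedral_rep_def)
qed

lemma finite_dihedral_group [simp]: "finite (carrier (dihedral_group n))"
  by (simp add: dihedral_group_def)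

lemma tau_map_mult:
  assumes "n \<ge> 1" "\<omega> ^ n = 1"
  shows "tau_map n \<omega> (u \<otimes>\<^bsub>dihedral_algebra n\<^esub> v) = tau_map n \<omega> u ** tau_map n \<omega> v"
  unfolding tau_map_eq_linear_extension
  by (rule linear_extension_mult)
     (use assms in \<open>simp_all add: dihedral_group_is_group dihedral_rep_mult\<close>)

text \<open>The adjugate of a \<open>2 \<times> 2\<close> matrix is linear in its entries, so the identity
  \<open>\<rho>(g\<^sup>-\<^sup>1) = adj(\<rho>(g))\<close> extends from the group to its algebra.\<close>

lemma tau_map_antipode:
  fixes \<omega> :: "'k::field alg_closure"
  assumes "n \<ge> 1" "\<omega> ^ n = 1" and char2: "\<And>x :: 'k alg_closure. - x = x"
  shows "tau_map n \<omega> (antipode (dihedral_group n) u) = adjugate2 (tau_map n \<omega> u)"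
proof -
  have "linear_extension (dihedral_group n) (\<lambda>g. dihedral_rep \<omega> (inv\<^bsub>dihedral_group n\<^esub> g)) u =
      linear_extension (dihedral_group n) (\<lambda>g. adjugate2 (dihedral_rep \<omega> g)) u"
    by (simp add: linear_extension_def dihedral_rep_inv[OF assms(2) _ char2] cong: sum.cong)
  then show ?thesis
    using assms by (simp add: tau_map_eq_linear_extension linear_extension_antipode
        dihedral_group_is_group adjugate2_linear_extension)
qed

section \<open>Left ideals of the component algebras\<close>

text \<open>The component algebras are copies of rings inside a sum type; this carries the closure
  properties of a left ideal back to the original ring.\<close>

lemma left_ideal_image_ringE:
  assumes "left_ideal J (image_ring \<phi> R)" "inj \<phi>"
  obtains B where "J = \<phi> ` B" "B \<subseteq> carrier R" "\<zero>\<^bsub>R\<^esub> \<in> B"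
    "\<And>x y. x \<in> B \<Longrightarrow> y \<in> B \<Longrightarrow> x \<oplus>\<^bsub>R\<^esub> y \<in> B"
    "\<And>x y. x \<in> carrier R \<Longrightarrow> y \<in> B \<Longrightarrow> x \<otimes>\<^bsub>R\<^esub> y \<in> B"
proof -
  define B where "B = \<phi> -` J \<inter> carrier R"
  have sub: "J \<subseteq> \<phi> ` carrier R"
    and zero: "\<phi> \<zero>\<^bsub>R\<^esub> \<in> J"
    and add: "\<And>x y. x \<in> J \<Longrightarrow> y \<in> J \<Longrightarrow> x \<oplus>\<^bsub>image_ring \<phi> R\<^esub> y \<in> J"
    and mult: "\<And>x y. x \<in> carrier R \<Longrightarrow> y \<in> J \<Longrightarrow> \<phi> x \<otimes>\<^bsub>image_ring \<phi> R\<^esub> y \<in> J"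
    using assms(1) unfolding left_ideal_def additive_subgroup_def subgroup_def
    by (auto simp: image_ring_carrier image_ring_zero)
  have eqs: "\<phi> x \<oplus>\<^bsub>image_ring \<phi> R\<^esub> \<phi> y = \<phi> (x \<oplus>\<^bsub>R\<^esub> y)" "\<phi> x \<otimes>\<^bsub>image_ring \<phi> R\<^esub> \<phi> y = \<phi> (x \<otimes>\<^bsub>R\<^esub> y)"
    if "x \<in> carrier R" "y \<in> carrier R" for x y
    using that inj_on_subset[OF assms(2) subset_UNIV, of "carrier R"]
    by (simp_all add: image_ring_def image_group_def monoid.defs)
  have mem: "x \<in> carrier R" if "\<phi> x \<in> J" for x
    using that sub assms(2) by (auto dest: injD)
  show thesis
  proof (rule that[of B])
    show "J = \<phi> ` B" using sub by (auto simp: B_def)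
    show "B \<subseteq> carrier R" by (auto simp: B_def)
    show "\<zero>\<^bsub>R\<^esub> \<in> B" using zero mem by (simp add: B_def)
    show "x \<oplus>\<^bsub>R\<^esub> y \<in> B" if "x \<in> B" "y \<in> B" for x y
      using that add[of "\<phi> x" "\<phi> y"] mem by (auto simp: B_def eqs)
    show "x \<otimes>\<^bsub>R\<^esub> y \<in> B" if "x \<in> carrier R" "y \<in> B" for x y
      using that mult[of x "\<phi> y"] mem by (auto simp: B_def eqs)
  qed
qed

text \<open>The entries of \<open>W adj(C)\<close> are, up to sign, the determinants formed from a row of \<open>W\<close> and a row of
  \<open>C\<close>.  For \<open>W\<close>, \<open>C\<close> in the ideal, the matrix with these two rows is in the ideal too, so it
  is singular, as the ideal is proper.  If conversely all these determinants vanish and \<open>C \<noteq> 0\<close>, then every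
  row of \<open>W\<close> is a multiple of a nonzero row of \<open>C\<close>, so \<open>W = Y C\<close> for some \<open>Y\<close>.\<close>

lemma mat2_proper_left_ideal_eq_annihilator:
  fixes S :: "'a::field set"
  assumes S: "0 \<in> S" "1 \<in> S" "\<And>x y. x \<in> S \<Longrightarrow> y \<in> S \<Longrightarrow> x + y \<in> S"
    "\<And>x. x \<in> S \<Longrightarrow> - x \<in> S"
    "\<And>x y. x \<in> S \<Longrightarrow> y \<in> S \<Longrightarrow> x * y \<in> S" "\<And>x. x \<in> S \<Longrightarrow> inverse x \<in> S"
    and sub: "B \<subseteq> carrier (mat2_ring S)"
    and add: "\<And>M N. M \<in> B \<Longrightarrow> N \<in> B \<Longrightarrow> M + N \<in> B"
    and mult: "\<And>M N. M \<in> carrier (mat2_ring S) \<Longrightarrow> N \<in> B \<Longrightarrow> M ** N \<in> B"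
    and zero: "0 \<in> B" and nonzero: "B \<noteq> {0}" and proper: "B \<noteq> carrier (mat2_ring S)"
    and W: "W \<in> carrier (mat2_ring S)"
  shows "W \<in> B \<longleftrightarrow> (\<forall>C\<in>B. W ** adjugate2 C = 0)"
proof
  have entries: "M $ i $ j \<in> S" if "M \<in> B" for M i j
    using that sub by (auto simp: mat2_ring_def)
  have mem_carrier: "mat22 a b c d \<in> carrier (mat2_ring S)"
    if "a \<in> S" "b \<in> S" "c \<in> S" "d \<in> S" for a b c d
    using that by (simp add: mat2_ring_def forall_2)
  have singular: "C$1$1 * C$2$2 = C$1$2 * C$2$1" if C: "C \<in> B" for C
  proof (rule ccontr)
    assume ne: "C$1$1 * C$2$2 \<noteq> C$1$2 * C$2$1"
    define d where "d = inverse (C$1$1 * C$2$2 - C$1$2 * C$2$1)"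
    have d: "d * (C$1$1 * C$2$2 - C$1$2 * C$2$1) = 1" using ne by (simp add: d_def)
    have "d \<in> S"
      unfolding d_def diff_conv_add_uminus by (intro S entries[OF C])
    define D where "D = mat22 (d * C$2$2) (- (d * C$1$2)) (- (d * C$2$1)) (d * C$1$1)"
    have "D \<in> carrier (mat2_ring S)"
      unfolding D_def using S entries[OF C] \<open>d \<in> S\<close> by (intro mem_carrier) auto
    moreover have "D ** C = mat 1"
      using d by (simp add: D_def mat2_simps algebra_simps)
    ultimately have one: "mat 1 \<in> B" using mult C by metis
    have "M \<in> B" if "M \<in> carrier (mat2_ring S)" for M
      using mult[OF that one] by simp
    then show False using sub proper by blast
  qed
  show "W \<in> B" if orth: "\<forall>C\<in>B. W ** adjugate2 C = 0"
  proof -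
    obtain C where C: "C \<in> B" "C \<noteq> 0" using zero nonzero by blast
    have "W ** adjugate2 C = 0" using orth C(1) by blast
    then have "\<forall>i k. W$i$1 * C$k$2 = W$i$2 * C$k$1"
      by (simp add: mat2_simps)
    then have eq: "W$i$1 * C$k$2 = W$i$2 * C$k$1" for i k by blast
    obtain k l where kl: "C$k$l \<noteq> 0" using C(2) by (auto simp: vec_eq_iff)
    define Y where "Y = (\<chi> i m. if m = k then W$i$l * inverse (C$k$l) else 0)"
    have "Y \<in> carrier (mat2_ring S)"
      using W S entries[OF C(1)] by (auto simp: Y_def mat2_ring_def)
    moreover have "Y ** C = W"
    proof -
      have "(Y ** C)$i$j = W$i$l * inverse (C$k$l) * C$k$j" for i j
        by (simp add: Y_def matrix_matrix_mult_def if_distrib if_distribR cong: if_cong)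
      moreover have "W$i$l * C$k$j = W$i$j * C$k$l" for i j
        using eq[of i k] exhaust_2[of l] exhaust_2[of j] by (auto simp: mult.commute)
      ultimately have "(Y ** C)$i$j = W$i$j" for i j
        using kl by (simp add: field_simps)
      then show ?thesis by (simp add: vec_eq_iff)
    qed
    ultimately show ?thesis using mult C(1) by metis
  qed
  show "\<forall>C\<in>B. W ** adjugate2 C = 0" if "W \<in> B"
  proof
    fix C assume C: "C \<in> B"
    have eq: "W$i$1 * C$k$2 = W$i$2 * C$k$1" for i k
    proof -
      \<comment> \<open>Matrix units that select row \<open>i\<close> of \<open>W\<close> as first and row \<open>k\<close> of \<open>C\<close> as second row.\<close>
      define E :: "'a^2^2" where "E = (\<chi> p m. if p = 1 \<and> m = i then 1 else 0)"
      define E' :: "'a^2^2" where "E' = (\<chi> p m. if p = 2 \<and> m = k then 1 else 0)"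
      have "E \<in> carrier (mat2_ring S)" "E' \<in> carrier (mat2_ring S)"
        using S by (auto simp: E_def E'_def mat2_ring_def)
      then have "E ** W + E' ** C \<in> B" using add mult C that by blast
      moreover have "(E ** W + E' ** C)$1$j = W$i$j" "(E ** W + E' ** C)$2$j = C$k$j" for j
        by (simp_all add: E_def E'_def matrix_matrix_mult_def if_distrib if_distribR cong: if_cong)
      ultimately show ?thesis using singular[of "E ** W + E' ** C"] by simp
    qed
    show "W ** adjugate2 C = 0" by (simp add: mat2_simps eq)
  qed
qed

lemma C2_mult:
  "u \<otimes>\<^bsub>group_algebra C2\<^esub> v = c2_elem (u 0 * v 0 + u 1 * v 1) (u 0 * v 1 + u 1 * v 0)"
proof -
  have carrier: "carrier C2 = {0, 1}" by (auto simp: carrier_integer_mod_group)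
  have "(0 :: int) \<in> carrier C2" "(1 :: int) \<in> carrier C2" by (simp_all add: carrier)
  then show ?thesis by (simp add: group_algebra_def carrier c2_elem_def fun_eq_iff)
qed

lemma C2_carrier: "x \<in> carrier (group_algebra C2) \<longleftrightarrow> x = c2_elem (x 0) (x 1)"
  by (auto simp: group_algebra_def c2_elem_def carrier_integer_mod_group fun_eq_iff)

lemma c2_elem_simps [simp]: "c2_elem a b 0 = a" "c2_elem a b 1 = b"
  by (simp_all add: c2_elem_def)

lemma c2_elem_eq_iff [simp]: "c2_elem a b = c2_elem c d \<longleftrightarrow> a = c \<and> b = d"
  by (metis c2_elem_simps)

text \<open>In characteristic 2 we have \<open>(x + y h)\<^sup>2 = (x + y)\<^sup>2\<close>, so the elements with \<open>x \<noteq> y\<close> are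
  units.  A proper nonzero left ideal therefore consists of the multiples of \<open>1 + h\<close>,
  and these are exactly the elements annihilated by \<open>1 + h\<close>.\<close>

lemma C2_proper_left_ideal_eq_annihilator:
  fixes B :: "(int \<Rightarrow> 'k::field) set"
  assumes char2: "\<And>x :: 'k. - x = x"
    and sub: "B \<subseteq> carrier (group_algebra C2)"
    and mult: "\<And>x y. x \<in> carrier (group_algebra C2) \<Longrightarrow> y \<in> B \<Longrightarrow> x \<otimes>\<^bsub>group_algebra C2\<^esub> y \<in> B"
    and zero: "\<zero>\<^bsub>group_algebra C2\<^esub> \<in> B" and nonzero: "B \<noteq> {\<zero>\<^bsub>group_algebra C2\<^esub>}"
    and proper: "B \<noteq> carrier (group_algebra C2)"
    and x: "x \<in> carrier (group_algebra C2)"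
  shows "x \<in> B \<longleftrightarrow> (\<forall>c\<in>B. x \<otimes>\<^bsub>group_algebra C2\<^esub> c = \<zero>\<^bsub>group_algebra C2\<^esub>)"
proof
  have zero_eq: "\<zero>\<^bsub>group_algebra C2\<^esub> = (c2_elem 0 0 :: int \<Rightarrow> 'k)"
    by (simp add: group_algebra_def c2_elem_def fun_eq_iff)
  have elem_mem: "c2_elem a b \<in> carrier (group_algebra C2)" for a b :: 'k
    by (simp add: C2_carrier)
  have double: "y + y = 0" for y :: 'k
    using char2[of y] by (metis add.right_inverse)
  have eqI: "y = z" if "y + z = 0" for y z :: 'k
    using that char2[of z] by (simp add: eq_neg_iff_add_eq_0[symmetric])
  have diagonal: "c 1 = c 0" if c: "c \<in> B" for c
  proof (rule ccontr)
    assume ne: "c 1 \<noteq> c 0"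
    then have "c 0 + c 1 \<noteq> 0" using eqI by metis
    define e where "e = inverse ((c 0 + c 1) * (c 0 + c 1))"
    have "(c 0 + c 1) * (c 0 + c 1) = c 0 * c 0 + c 1 * c 1"
      using double[of "c 0 * c 1"] by (simp add: algebra_simps)
    then have e: "e * c 0 * c 0 + e * c 1 * c 1 = 1"
      using \<open>c 0 + c 1 \<noteq> 0\<close> unfolding e_def mult.assoc distrib_left[symmetric]
      by (metis left_inverse mult_eq_0_iff)
    have one: "c2_elem 1 0 \<in> B"
      using mult[OF elem_mem c, of "e * c 0" "e * c 1"] e double
      by (simp add: C2_mult algebra_simps)
    have "y \<in> B" if "y \<in> carrier (group_algebra C2)" for y
      using mult[OF that one] that by (simp add: C2_mult C2_carrier)
    then show False using sub proper by blast
  qed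
  show "x \<in> B" if orth: "\<forall>c\<in>B. x \<otimes>\<^bsub>group_algebra C2\<^esub> c = \<zero>\<^bsub>group_algebra C2\<^esub>"
  proof -
    obtain c where c: "c \<in> B" "c \<noteq> c2_elem 0 0"
      using zero nonzero unfolding zero_eq by blast
    have "c = c2_elem (c 0) (c 0)"
      using subsetD[OF sub c(1)] diagonal[OF c(1)] by (metis C2_carrier)
    then have ne: "c 0 \<noteq> 0" using c(2) by auto
    have "x 0 * c 0 + x 1 * c 0 = 0"
      using orth c(1) diagonal[OF c(1)] by (auto simp: C2_mult zero_eq)
    then have "x 1 = x 0"
      using ne eqI[of "x 0" "x 1"] by (simp flip: distrib_right)
    then have "x = c2_elem (x 0 / c 0) 0 \<otimes>\<^bsub>group_algebra C2\<^esub> c"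
      using x ne diagonal[OF c(1)] by (simp add: C2_mult C2_carrier)
    then show ?thesis using mult[OF elem_mem c(1)] by metis
  qed
  show "\<forall>c\<in>B. x \<otimes>\<^bsub>group_algebra C2\<^esub> c = \<zero>\<^bsub>group_algebra C2\<^esub>" if "x \<in> B"
  proof
    fix c assume "c \<in> B"
    then show "x \<otimes>\<^bsub>group_algebra C2\<^esub> c = \<zero>\<^bsub>group_algebra C2\<^esub>"
      by (simp only: C2_mult zero_eq double diagonal[OF that] diagonal)
  qed
qed

section \<open>The irreducible factors of $x^n - 1$ and their roots\<close>

locale dihedral_decomposition_char2 =
  fixes n r s :: nat
    and f :: "nat \<Rightarrow> 'k::{field,finite} poly"
    and \<alpha> :: "nat \<Rightarrow> 'k alg_closure"
  assumes even_card: "even CARD('k)"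
    and n_ge_2: "n \<ge> 2"
    and coprime_card: "coprime CARD('k) n"
    and factorization: "dihedral_factorization n r s f"
    and root: "\<And>j. j \<in> {1..r + s} \<Longrightarrow> ac_eval (f j) (\<alpha> j) = 0"
begin

lemma n_ge_1: "n \<ge> 1"
  using n_ge_2 by simp

lemma char2: "- x = x" for x :: 'k
  using even_card by (rule uminus_eq_if_even_card)

lemma char2_closure: "- x = x" for x :: "'k alg_closure"
  using char2[of 1] by (metis mult_minus1 mult_1 to_ac_1 to_ac_minus)

lemma odd_n: "odd n"
  using even_card coprime_card coprime_common_divisor by fastforce

lemma zeta_n: "zeta n = 1"
  using odd_n by (simp add: zeta_def)

abbreviation "xn_factors \<equiv> irreducible_factors r s f"

lemma r_ge_1: "r \<ge> 1"
  using factorization zeta_n by (simp add: dihedral_factorization_def)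

lemma distinct_factors: "distinct xn_factors"
  using factorization by (simp add: dihedral_factorization_def)

lemma factors_irreducible:
  assumes "g \<in> set xn_factors"
  shows "Factorial_Ring.irreducible g" "Polynomial.lead_coeff g = 1"
  using assms factorization by (simp_all add: dihedral_factorization_def)

lemma f_mem: "j \<in> {1..r + s} \<Longrightarrow> f j \<in> set xn_factors"
  by (auto simp: irreducible_factors_def simp del: upt_Suc)

lemma prod_factors: "prod_list xn_factors = Polynomial.monom 1 n - 1"
proof -
  have "{1..r + s} = {1..r} \<union> {r + 1..r + s}" by auto
  then have split: "prod f {1..r + s} = prod f {1..r} * prod f {r + 1..r + s}"
    by (simp add: prod.union_disjoint)
  have "prod_list xn_factors = prod f {1..r + s} * (\<Prod>j\<in>{r + 1..r + s}. monic_reflect (f j))"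
    unfolding irreducible_factors_def prod_list.append
    by (simp add: prod.distinct_set_conv_list[symmetric] atLeastLessThanSuc_atLeastAtMost
        del: upt_Suc)
  then show ?thesis
    using factorization unfolding dihedral_factorization_def split
    by (simp only: prod.distrib mult.assoc)
qed

lemma root_of_unity:
  assumes "g \<in> set xn_factors" "ac_eval g x = 0"
  shows "x ^ n = 1"
proof -
  have "g dvd Polynomial.monom 1 n - 1"
    using assms(1) by (simp add: prod_list_dvd flip: prod_factors)
  then have "ac_eval (Polynomial.monom 1 n - 1) x = 0"
    using assms(2) by (auto elim!: dvdE simp del: ac_eval_diff)
  then show ?thesis by simp
qed

lemma \<alpha>_power: "j \<in> {1..r + s} \<Longrightarrow> \<alpha> j ^ n = 1"
  using root_of_unity f_mem root by blast

lemma \<alpha>_nonzero: "j \<in> {1..r + s} \<Longrightarrow> \<alpha> j \<noteq> 0"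
  using \<alpha>_power[of j] n_ge_1 by (auto simp: zero_power)

lemma \<alpha>_inverse: "j \<in> {1..r + s} \<Longrightarrow> inverse (\<alpha> j) = \<alpha> j ^ (n - 1)"
  using power_diff_of_root_of_unity[OF \<alpha>_power, of j 1] n_ge_1 by simp

lemma \<alpha>_1: "\<alpha> 1 = 1"
  using root[of 1] factorization r_ge_1 by (simp add: dihedral_factorization_def)

text \<open>Each root of \<open>x\<^sup>n - 1\<close> belongs to a single factor.\<close>

lemma factor_unique:
  assumes "g \<in> set xn_factors" "h \<in> set xn_factors" "ac_eval g x = 0" "ac_eval h x = 0"
  shows "g = h"
  using irreducible_dvd_if_common_root[of g x h] monic_irreducible_eqI[of g h]
    factors_irreducible assms by blast

text \<open>The irreducible factor that has \<open>\<alpha>\<^sub>j\<^sup>-\<^sup>1\<close> as a root.\<close>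

definition inverse_factor :: "nat \<Rightarrow> 'k poly" where
  "inverse_factor j = (if j \<le> r then f j else monic_reflect (f j))"

lemma inverse_factor_mem: "j \<in> {1..r + s} \<Longrightarrow> inverse_factor j \<in> set xn_factors"
  by (auto simp: inverse_factor_def irreducible_factors_def simp del: upt_Suc)

lemma inverse_factor_root:
  assumes j: "j \<in> {1..r + s}"
  shows "ac_eval (inverse_factor j) (inverse (\<alpha> j)) = 0"
proof -
  have "ac_eval (reflect_poly (f j)) (inverse (\<alpha> j)) = 0"
    using ac_eval_reflect_poly[of "inverse (\<alpha> j)" "f j"] \<alpha>_nonzero[OF j] root[OF j] by simp
  moreover have "reflect_poly (f j) = f j" if "1 < j" "j \<le> r"
    using that factorization by (auto simp: dihedral_factorization_def)
  moreover have "j = 1 \<or> 1 < j" using j by auto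
  ultimately show ?thesis
    using root[OF j] \<alpha>_1 r_ge_1 by (auto simp: inverse_factor_def monic_reflect_def)
qed

lemma inj_f: "inj_on f {1..r + s}"
proof -
  have "{1..<Suc (r + s)} = {1..r + s}" by auto
  then show ?thesis
    using distinct_factors by (simp add: irreducible_factors_def distinct_map del: upt_Suc)
qed

lemma f_neq_inverse_factor:
  assumes "i \<in> {1..r + s}" "j \<in> {1..r + s}" "i \<noteq> j"
  shows "f j \<noteq> inverse_factor i"
proof (cases "i \<le> r")
  case True
  then show ?thesis using inj_f assms by (auto simp: inverse_factor_def dest: inj_onD)
next
  case False
  then have "i \<in> {r + 1..<r + s + 1}" "j \<in> {1..<r + s + 1}" using assms by auto
  moreover have "f ` {1..<r + s + 1} \<inter> (\<lambda>i. monic_reflect (f i)) ` {r + 1..<r + s + 1} = {}"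
    using distinct_factors by (simp add: irreducible_factors_def del: upt_Suc)
  ultimately have "f j \<noteq> monic_reflect (f i)" by blast
  then show ?thesis using False by (simp add: inverse_factor_def)
qed

text \<open>The matrix \<open>Z\<^sub>j\<close> has determinant \<open>\<alpha>\<^sub>j - \<alpha>\<^sub>j\<^sup>-\<^sup>1\<close>.  In characteristic 2 it vanishes only for
  \<open>\<alpha>\<^sub>j = 1\<close>, which is the root of \<open>f\<^sub>1\<close>.\<close>

lemma \<alpha>_neq_inverse:
  assumes "j \<in> {1..r + s}" "j \<noteq> 1"
  shows "\<alpha> j \<noteq> inverse (\<alpha> j)"
proof
  assume eq: "\<alpha> j = inverse (\<alpha> j)"
  have "\<alpha> j = 1 \<or> \<alpha> j = - 1"
    using eq \<alpha>_nonzero[OF assms(1)] by (metis power2_eq_1_iff power2_eq_square right_inverse)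
  then have "\<alpha> j = \<alpha> 1" using char2_closure[of 1] \<alpha>_1 by simp
  then have "f j = f 1"
    using factor_unique[OF f_mem f_mem, of j 1] root[of 1] root[of j] assms r_ge_1 by simp
  then show False using inj_f assms r_ge_1 by (auto dest: inj_onD)
qed

text \<open>Every factor of \<open>x\<^sup>n - 1\<close> has some \<open>\<alpha>\<^sub>j\<close> or \<open>\<alpha>\<^sub>j\<^sup>-\<^sup>1\<close> as a root, hence divides \<open>p\<close>, and the
  factors are pairwise coprime.  This is what makes the decomposition map injective.\<close>

lemma poly_eq_0_if_vanishes:
  assumes deg: "Polynomial.degree p < n"
    and zeros: "\<And>j. j \<in> {1..r + s} \<Longrightarrow> ac_eval p (\<alpha> j) = 0 \<and> ac_eval p (inverse (\<alpha> j)) = 0"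
  shows "p = 0"
proof (rule ccontr)
  assume "p \<noteq> 0"
  have "g dvd p" if g: "g \<in> set xn_factors" for g
  proof -
    have "\<exists>j\<in>{1..r + s}. g = f j \<or> g = inverse_factor j"
    proof -
      consider j where "j \<in> {1..<r + s + 1}" "g = f j"
        | j where "j \<in> {r + 1..<r + s + 1}" "g = monic_reflect (f j)"
        using g by (auto simp: irreducible_factors_def simp del: upt_Suc)
      then show ?thesis
      proof cases
        case (1 j)
        then show ?thesis by (intro bexI[of _ j]) auto
      next
        case (2 j)
        then show ?thesis by (intro bexI[of _ j]) (auto simp: inverse_factor_def)
      qed
    qed
    then obtain x where "ac_eval g x = 0" "ac_eval p x = 0"
      using zeros root inverse_factor_root by metis
    then show ?thesis
      using irreducible_dvd_if_common_root factors_irreducible(1)[OF g] by blast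
  qed
  then have "Polynomial.monom 1 n - 1 dvd p"
    using distinct_irreducibles_prod_dvd[of xn_factors p] distinct_factors factors_irreducible
    by (simp add: prod_factors)
  moreover have "n \<le> Polynomial.degree (Polynomial.monom 1 n - 1 :: 'k poly)"
    using n_ge_1 by (intro le_degree) (simp add: coeff_1)
  ultimately show False
    using deg \<open>p \<noteq> 0\<close> dvd_imp_degree_le by (metis leD order_trans)
qed

section \<open>Kernel and supports of the decomposition map\<close>

lemma degree_lt_sum_monom: "Polynomial.degree (\<Sum>i<n. Polynomial.monom (c i) i) < n"
proof -
  have "Polynomial.degree (\<Sum>i<n. Polynomial.monom (c i) i) \<le> n - 1"
    by (rule degree_sum_le) (auto intro!: order_trans[OF degree_monom_le])
  then show ?thesis using n_ge_1 by simp
qed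

lemma tau_map_eq_0_iff:
  "tau_map n \<omega> u = 0 \<longleftrightarrow>
    ac_eval (P_poly n u) \<omega> = 0 \<and> ac_eval (P_poly n u) (inverse \<omega>) = 0 \<and>
    ac_eval (Q_poly n u) \<omega> = 0 \<and> ac_eval (Q_poly n u) (inverse \<omega>) = 0"
  by (auto simp: tau_map_def vec_eq_iff forall_2)

lemma eq_zero_if_tau_maps_vanish:
  assumes u: "u \<in> carrier (dihedral_algebra n)"
    and zeros: "\<And>j. j \<in> {1..r + s} \<Longrightarrow> tau_map n (\<alpha> j) u = 0"
  shows "u = \<zero>\<^bsub>dihedral_algebra n\<^esub>"
proof -
  have "P_poly n u = 0" "Q_poly n u = 0"
    using zeros degree_lt_sum_monom
    by (auto intro!: poly_eq_0_if_vanishes simp: tau_map_eq_0_iff P_poly_def Q_poly_def)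
  moreover have "Polynomial.coeff (P_poly n u) i = u (False, i)" "Polynomial.coeff (Q_poly n u) i = u (True, i)"
    if "i < n" for i
    using that by (simp_all add: P_poly_def Q_poly_def coeff_sum)
  ultimately have "u (e, i) = 0" if "i < n" for e i
    using that by (cases e) (metis coeff_0)+
  moreover have "u (e, i) = 0" if "\<not> i < n" for e i
    using that u by (simp add: group_algebra_def dihedral_group_def)
  ultimately show ?thesis by (auto simp: group_algebra_def fun_eq_iff)
qed

text \<open>The witness is \<open>(x\<^sup>n - 1)/f\<^sub>j\<close> at \<open>a\<close>: all \<open>\<alpha>\<^sub>i\<close> and \<open>\<alpha>\<^sub>i\<^sup>-\<^sup>1\<close> with \<open>i \<noteq> j\<close> are roots of
  \<open>x\<^sup>n - 1\<close> but not of \<open>f\<^sub>j\<close>.\<close>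

lemma ex_supported_on_component:
  assumes j: "j \<in> {1..r + s}"
  obtains u where "u \<in> carrier (dihedral_algebra n)" "u \<noteq> \<zero>\<^bsub>dihedral_algebra n\<^esub>"
    "\<And>i. i \<in> {1..r + s} \<Longrightarrow> i \<noteq> j \<Longrightarrow> tau_map n (\<alpha> i) u = 0"
proof -
  have "f j dvd Polynomial.monom 1 n - 1"
    using f_mem[OF j] by (simp add: prod_list_dvd flip: prod_factors)
  then obtain p where p: "Polynomial.monom 1 n - 1 = f j * p" by (auto elim: dvdE)
  have deg: "Polynomial.degree (Polynomial.monom 1 n - 1 :: 'k poly) = n"
    using n_ge_1 by (subst diff_conv_add_uminus, subst degree_add_eq_left) (simp_all add: degree_monom_eq)
  then have "f j * p \<noteq> 0" using p n_ge_1 by auto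
  then have "p \<noteq> 0" "f j \<noteq> 0" by auto
  have "Polynomial.degree (f j) > 0"
    using factors_irreducible(1)[OF f_mem[OF j]]
    by (auto simp: Factorial_Ring.irreducible_def is_unit_iff_degree)
  then have deg_p: "Polynomial.degree p < n"
    using deg p \<open>p \<noteq> 0\<close> \<open>f j \<noteq> 0\<close> by (simp add: degree_mult_eq)
  have vanish: "ac_eval p x = 0" if "x ^ n = 1" "ac_eval (f j) x \<noteq> 0" for x
  proof -
    have "ac_eval (f j) x * ac_eval p x = 0"
      using that(1) arg_cong[OF p, of "\<lambda>g. ac_eval g x"] by simp
    then show ?thesis using that(2) by simp
  qed
  define u where "u = (\<lambda>(e, i). if \<not> e \<and> i < n then Polynomial.coeff p i else 0)"
  have P: "P_poly n u = p"
    using deg_p by (intro poly_eqI) (auto simp: P_poly_def u_def coeff_sum coeff_eq_0)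
  have Q: "Q_poly n u = 0"
    by (simp add: Q_poly_def u_def)
  show thesis
  proof (rule that[of u])
    show "u \<in> carrier (dihedral_algebra n)"
      by (auto simp: group_algebra_def dihedral_group_def u_def)
    show "u \<noteq> \<zero>\<^bsub>dihedral_algebra n\<^esub>"
      using P \<open>p \<noteq> 0\<close> by (auto simp: group_algebra_def P_poly_def)
    fix i assume i: "i \<in> {1..r + s}" "i \<noteq> j"
    have "ac_eval (f j) (\<alpha> i) \<noteq> 0"
      using factor_unique[OF f_mem f_mem, of i j] root[OF i(1)] inj_onD[OF inj_f] i j by metis
    moreover have "ac_eval (f j) (inverse (\<alpha> i)) \<noteq> 0"
      using factor_unique[OF f_mem inverse_factor_mem, of j i] inverse_factor_root[OF i(1)]
        f_neq_inverse_factor[OF i(1) j i(2)] i j by metis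
    ultimately show "tau_map n (\<alpha> i) u = 0"
      using \<alpha>_power[OF i(1)] vanish by (simp add: tau_map_eq_0_iff P Q power_inverse)
  qed
qed

end

section \<open>Orthogonality in the components\<close>

lemma matrix_inv_unique:
  fixes A B :: "'a::field^'n^'n"
  assumes "A ** B = mat 1" "B ** A = mat 1"
  shows "matrix_inv A = B"
proof -
  have "A ** matrix_inv A = mat 1"
    unfolding matrix_inv_def using assms by (rule_tac someI2[of _ B]) auto
  then have "B ** (A ** matrix_inv A) = B" by simp
  then show ?thesis using assms by (simp add: matrix_mul_assoc)
qed

text \<open>The formula \<open>adj(M) = tr(M) - M\<close> shows that the adjugate commutes with conjugation.\<close>

lemma adjugate2_conjugate:
  fixes M Z Z' :: "'a::field^2^2"
  assumes "Z ** Z' = mat 1"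
  shows "adjugate2 (Z' ** M ** Z) = Z' ** adjugate2 M ** Z"
proof -
  have adj: "adjugate2 A = mat (A$1$1 + A$2$2) - A" for A :: "'a^2^2"
    by (simp add: mat2_simps)
  have trace: "(A ** B)$1$1 + (A ** B)$2$2 = (B ** A)$1$1 + (B ** A)$2$2" for A B :: "'a^2^2"
    by (simp add: mat2_simps algebra_simps)
  have scalar: "Z' ** (mat c - M) ** Z = mat c ** (Z' ** Z) - Z' ** M ** Z" for c
    by (simp add: mat2_simps algebra_simps)
  have left: "Z' ** Z = mat 1" using assms by (simp add: matrix_left_right_inverse)
  have "Z ** (Z' ** M) = M" by (simp add: matrix_mul_assoc assms)
  then have "(Z' ** M ** Z)$1$1 + (Z' ** M ** Z)$2$2 = M$1$1 + M$2$2"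
    using trace[of "Z' ** M" Z] by simp
  then show ?thesis unfolding adj[of M] adj[of "Z' ** M ** Z"] scalar left by simp
qed

text \<open>The inverse is the adjugate divided by the determinant \<open>x - x\<^sup>-\<^sup>1\<close>.\<close>

lemma Z_mat_inverse:
  fixes x :: "'a::field"
  assumes "x \<noteq> inverse x"
  defines "d \<equiv> inverse (x - inverse x)"
  defines "Z' \<equiv> mat22 (- (d * inverse x)) (d * x) (- d) d"
  shows "Z_mat x ** Z' = mat 1" "Z' ** Z_mat x = mat 1" "matrix_inv (Z_mat x) = Z'"
proof -
  have "x - inverse x \<noteq> 0" using assms(1) by simp
  then have "d * (x - inverse x) = 1" unfolding d_def by (rule left_inverse)
  then have d: "d * x - d * inverse x = 1" by (simp only: right_diff_distrib)
  have mult: "mat22 1 (- x) 1 (- y) ** mat22 (- (d * y)) (d * x) (- d) d = mat 1"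
    "mat22 (- (d * y)) (d * x) (- d) d ** mat22 1 (- x) 1 (- y) = mat 1"
    if "d * x - d * y = 1" for d x y :: 'a
    using that by (simp_all add: mat2_simps mult.commute mult.left_commute)
  show 1: "Z_mat x ** Z' = mat 1" and 2: "Z' ** Z_mat x = mat 1"
    unfolding Z_mat_def Z'_def by (fact mult[OF d])+
  show "matrix_inv (Z_mat x) = Z'"
    by (rule matrix_inv_unique[OF 1 2])
qed

lemma matrix_sandwich_eq_0_iff:
  fixes M Z Z' :: "'a::field^'n^'n"
  assumes "Z ** Z' = mat 1"
  shows "Z' ** M ** Z = 0 \<longleftrightarrow> M = 0"
proof
  assume "Z' ** M ** Z = 0"
  then have "Z ** (Z' ** M ** Z) ** Z' = 0" by simp
  moreover have "Z ** (Z' ** M ** Z) ** Z' = (Z ** Z') ** M ** (Z ** Z')"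
    by (simp only: matrix_mul_assoc)
  ultimately show "M = 0" by (simp add: assms)
qed simp

lemma sigma_map_eq_0_iff:
  assumes "x \<noteq> inverse x"
  shows "sigma_map x M = 0 \<longleftrightarrow> M = 0"
  using Z_mat_inverse[OF assms] by (simp add: sigma_map_def matrix_sandwich_eq_0_iff)

lemma sigma_map_mult_adjugate2:
  assumes "x \<noteq> inverse x"
  shows "sigma_map x M ** adjugate2 (sigma_map x N) = sigma_map x (M ** adjugate2 N)"
proof -
  let ?Z = "Z_mat x" and ?Z' = "matrix_inv (Z_mat x)"
  have Z: "?Z ** ?Z' = mat 1" using Z_mat_inverse[OF assms] by simp
  have "?Z' ** M ** ?Z ** (?Z' ** adjugate2 N ** ?Z) = ?Z' ** M ** (?Z ** ?Z') ** adjugate2 N ** ?Z"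
    by (simp only: matrix_mul_assoc)
  then show ?thesis
    by (simp add: sigma_map_def adjugate2_conjugate[OF Z] Z matrix_mul_assoc)
qed

text \<open>The relation that the dot product induces on a component.  The mixed cases pair
  elements of components of different kinds, which never occurs.\<close>

fun component_orthogonal :: "'k::field component \<Rightarrow> 'k component \<Rightarrow> bool" where
  "component_orthogonal (Inl x) (Inl y) \<longleftrightarrow> x \<otimes>\<^bsub>group_algebra C2\<^esub> y = \<zero>\<^bsub>group_algebra C2\<^esub>"
| "component_orthogonal (Inr M) (Inr N) \<longleftrightarrow> M ** adjugate2 N = 0"
| "component_orthogonal _ _ \<longleftrightarrow> False"

lemma C2_zero: "\<zero>\<^bsub>group_algebra C2\<^esub> = c2_elem 0 0"
  by (simp add: group_algebra_def c2_elem_def fun_eq_iff)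

lemma C2_one: "\<one>\<^bsub>group_algebra C2\<^esub> = c2_elem 1 0"
  by (auto simp: group_algebra_def c2_elem_def fun_eq_iff)

context dihedral_decomposition_char2
begin

abbreviation "A j \<equiv> component_algebra n r \<alpha> j"

abbreviation "\<P> j \<equiv> component_map n r \<alpha> j"

abbreviation "\<tau> j \<equiv> tau_map n (\<alpha> j)"

definition entry_field :: "nat \<Rightarrow> 'k alg_closure set" where
  "entry_field j = (if j \<le> r then adjoin (\<alpha> j + inverse (\<alpha> j)) else adjoin (\<alpha> j))"

lemma A_1: "A 1 = image_ring Inl (group_algebra C2)"
  by (simp add: component_algebra_def zeta_n)

lemma A_matrix: "j \<in> {1..r + s} \<Longrightarrow> j \<noteq> 1 \<Longrightarrow> A j = image_ring Inr (mat2_ring (entry_field j))"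
  by (auto simp: component_algebra_def zeta_n entry_field_def)

lemma \<P>_1: "\<P> 1 u = Inl (gamma_map n 1 u)"
  by (simp add: component_map_def zeta_n)

lemma \<P>_matrix:
  "j \<in> {1..r + s} \<Longrightarrow> j \<noteq> 1 \<Longrightarrow> \<P> j u = Inr (if j \<le> r then sigma_map (\<alpha> j) (\<tau> j u) else \<tau> j u)"
  by (auto simp: component_map_def zeta_n)

lemma \<tau>_1:
  "\<tau> 1 u = vector [vector [to_ac (poly (P_poly n u) 1), to_ac (poly (Q_poly n u) 1)],
                   vector [to_ac (poly (Q_poly n u) 1), to_ac (poly (P_poly n u) 1)]]"
  using ac_eval_to_ac[of _ "1 :: 'k"] by (simp add: tau_map_def \<alpha>_1[simplified])

lemma A_zero: "\<zero>\<^bsub>A j\<^esub> = (if j = 1 then Inl (c2_elem 0 0) else Inr 0)" if "j \<in> {1..r + s}"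
  using that A_1 A_matrix[OF that] by (auto simp: image_ring_zero C2_zero mat2_ring_def)

lemma \<P>_eq_zero_iff:
  assumes j: "j \<in> {1..r + s}"
  shows "\<P> j u = \<zero>\<^bsub>A j\<^esub> \<longleftrightarrow> \<tau> j u = 0"
proof (cases "j = 1")
  case True
  show ?thesis
    unfolding True A_1 image_ring_zero C2_zero \<P>_1 \<tau>_1 gamma_map_def
    by (auto simp: vec_eq_iff forall_2)
next
  case False
  then show ?thesis
    using \<alpha>_neq_inverse[OF j False] by (simp add: \<P>_matrix[OF j] A_zero[OF j] sigma_map_eq_0_iff)
qed

text \<open>For \<open>j = 1\<close> the matrix \<open>\<tau>\<^sub>1(u)\<close> is the multiplication matrix of \<open>P(1) + Q(1) h\<close>, and in characteristic 2 it is
  its own adjugate.  For the other components the relation is the same before and after conjugation by \<open>Z\<^sub>j\<close>.\<close>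

lemma component_orthogonal_\<P>_iff:
  assumes j: "j \<in> {1..r + s}"
  shows "component_orthogonal (\<P> j u) (\<P> j v) \<longleftrightarrow> \<tau> j u ** adjugate2 (\<tau> j v) = 0"
proof (cases "j = 1")
  case True
  then show ?thesis
    by (simp only: \<P>_1 \<tau>_1 gamma_map_def component_orthogonal.simps C2_mult C2_zero)
       (auto simp: mat2_simps char2_closure add.commute simp flip: to_ac_mult to_ac_add)
next
  case False
  then show ?thesis
    using \<alpha>_neq_inverse[OF j False]
    by (simp add: \<P>_matrix[OF j] sigma_map_mult_adjugate2 sigma_map_eq_0_iff)
qed

text \<open>Each entry is a difference of quotients \<open>(g(\<alpha>\<^sub>j) - g(\<alpha>\<^sub>j\<^sup>-\<^sup>1))/(\<alpha>\<^sub>j - \<alpha>\<^sub>j\<^sup>-\<^sup>1)\<close> with polynomials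
  \<open>g\<close> built from \<open>P\<close> and \<open>Q\<close>.\<close>

lemma sigma_tau_in_adjoin:
  assumes j: "j \<in> {1..r + s}" "j \<noteq> 1"
  shows "sigma_map (\<alpha> j) (\<tau> j u) $ k $ l \<in> adjoin (\<alpha> j + inverse (\<alpha> j))"
proof -
  let ?x = "\<alpha> j" and ?P = "P_poly n u" and ?Q = "Q_poly n u"
  let ?y = "inverse ?x"
  define D where "D = (\<lambda>p. (ac_eval p ?x - ac_eval p ?y) / (?x - ?y))"
  have D: "D p \<in> adjoin (?x + ?y)" for p
    unfolding D_def
    by (rule difference_quotient_in_adjoin[OF \<alpha>_nonzero \<alpha>_neq_inverse]) (use j in auto)
  \<comment> \<open>\<open>x\<^bsup>n - 1\<^esup> P\<close> takes the values of \<open>x\<^sup>-\<^sup>1 P\<close> at \<open>\<alpha>\<^sub>j\<close> and \<open>\<alpha>\<^sub>j\<^sup>-\<^sup>1\<close>, as both are \<open>n\<close>-th roots of unity.\<close>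
  let ?P' = "Polynomial.monom 1 (n - 1) * ?P"
  have pow: "?x ^ (n - 1) = ?y" "?y ^ (n - 1) = ?x"
    using \<alpha>_inverse[OF j(1)] by (metis, metis inverse_inverse_eq power_inverse)
  have xy: "?x * ?y = 1" using \<alpha>_nonzero[OF j(1)] by simp
  have product: "mat22 (- (d * y)) (d * x) (- d) d ** mat22 p q' q p' ** mat22 1 (- x) 1 (- y) =
      mat22 ((x * q - y * q') * d - (y * p - x * p') * d)
            ((p - p') * d - (x * (x * q) - y * (y * q')) * d)
            ((q - q') * d - (p - p') * d)
            ((x * p - y * p') * d - (x * q - y * q') * d)"
    if "x * y = 1" for d x y p p' q q' :: "'k alg_closure"
    by (simp add: mat2_simps algebra_simps that)
  have "sigma_map ?x (\<tau> j u) =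
      mat22 (D (pCons 0 ?Q) - D ?P') (D ?P - D (pCons 0 (pCons 0 ?Q)))
            (D ?Q - D ?P) (D (pCons 0 ?P) - D (pCons 0 ?Q))"
    unfolding sigma_map_def Z_mat_inverse(3)[OF \<alpha>_neq_inverse[OF j]]
    unfolding Z_mat_def tau_map_def product[OF xy]
    by (simp add: D_def divide_inverse pow[simplified])
  then show ?thesis
    using exhaust_2[of k] exhaust_2[of l] by (auto intro!: adjoin_closed D)
qed

lemma \<P>_in_carrier:
  assumes j: "j \<in> {1..r + s}"
  shows "\<P> j u \<in> carrier (A j)"
proof (cases "j = 1")
  case True
  then show ?thesis
    by (simp only: \<P>_1 A_1 image_ring_carrier gamma_map_def) (simp add: C2_carrier)
next
  case False
  have "ac_eval p (inverse (\<alpha> j)) \<in> adjoin (\<alpha> j)" for p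
    by (intro adjoin_ac_eval_closed adjoin_inverse_closed adjoin_closed)
  moreover have "ac_eval p (\<alpha> j) \<in> adjoin (\<alpha> j)" for p
    by (intro adjoin_ac_eval_closed adjoin_closed)
  ultimately have "\<tau> j u $ k $ l \<in> adjoin (\<alpha> j)" for k l
    using exhaust_2[of k] exhaust_2[of l]
    by (auto simp: tau_map_def)
  then show ?thesis
    using False sigma_tau_in_adjoin[OF j False]
    by (simp add: \<P>_matrix[OF j] A_matrix[OF j] image_ring_carrier mat2_ring_def entry_field_def)
qed

lemma one_not_self_orthogonal:
  assumes j: "j \<in> {1..r + s}"
  shows "\<one>\<^bsub>A j\<^esub> \<in> carrier (A j)" "\<not> component_orthogonal \<one>\<^bsub>A j\<^esub> \<one>\<^bsub>A j\<^esub>"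
proof -
  show "\<one>\<^bsub>A j\<^esub> \<in> carrier (A j)"
  proof (cases "j = 1")
    case True
    then show ?thesis by (simp only: A_1 image_ring_carrier image_ring_one C2_one) (simp add: C2_carrier)
  next
    case False
    then show ?thesis
      by (auto simp: A_matrix[OF j] image_ring_carrier image_ring_one mat2_ring_def mat_def
          entry_field_def intro!: imageI adjoin_closed)
  qed
  show "\<not> component_orthogonal \<one>\<^bsub>A j\<^esub> \<one>\<^bsub>A j\<^esub>"
  proof (cases "j = 1")
    case True
    then show ?thesis
      by (simp only: A_1 image_ring_one C2_one component_orthogonal.simps C2_mult C2_zero) simp
  next
    case False
    then show ?thesis
      by (simp add: A_matrix[OF j] image_ring_one mat2_ring_def) (simp add: mat2_simps)
  qed
qed

lemma proper_left_ideal_eq_annihilator: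
  assumes j: "j \<in> {1..r + s}"
    and ideal: "left_ideal J (A j)"
    and nonzero: "J \<noteq> {\<zero>\<^bsub>A j\<^esub>}" and proper: "J \<noteq> carrier (A j)"
    and w: "w \<in> carrier (A j)"
  shows "w \<in> J \<longleftrightarrow> (\<forall>c\<in>J. component_orthogonal w c)"
proof (cases "j = 1")
  case True
  note A = A_1[folded True]
  obtain B where B: "J = Inl ` B" "B \<subseteq> carrier (group_algebra C2)" "\<zero>\<^bsub>group_algebra C2\<^esub> \<in> B"
    "\<And>x y. x \<in> carrier (group_algebra C2) \<Longrightarrow> y \<in> B \<Longrightarrow> x \<otimes>\<^bsub>group_algebra C2\<^esub> y \<in> B"
    using ideal unfolding A by (rule left_ideal_image_ringE) simp_all
  obtain x where x: "w = Inl x" "x \<in> carrier (group_algebra C2)"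
    using w by (auto simp: A image_ring_carrier)
  have "B \<noteq> {\<zero>\<^bsub>group_algebra C2\<^esub>}" "B \<noteq> carrier (group_algebra C2)"
    using nonzero proper B(1) by (auto simp: A image_ring_carrier image_ring_zero)
  then have "x \<in> B \<longleftrightarrow> (\<forall>c\<in>B. x \<otimes>\<^bsub>group_algebra C2\<^esub> c = \<zero>\<^bsub>group_algebra C2\<^esub>)"
    by (intro C2_proper_left_ideal_eq_annihilator char2 B x(2))
  then show ?thesis using B(1) x(1) by auto
next
  case False
  let ?R = "mat2_ring (entry_field j)"
  note A = A_matrix[OF j False]
  obtain B where B: "J = Inr ` B" "B \<subseteq> carrier ?R" "\<zero>\<^bsub>?R\<^esub> \<in> B"
    "\<And>x y. x \<in> B \<Longrightarrow> y \<in> B \<Longrightarrow> x \<oplus>\<^bsub>?R\<^esub> y \<in> B"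
    "\<And>x y. x \<in> carrier ?R \<Longrightarrow> y \<in> B \<Longrightarrow> x \<otimes>\<^bsub>?R\<^esub> y \<in> B"
    using ideal unfolding A by (rule left_ideal_image_ringE) simp_all
  have ops: "\<zero>\<^bsub>?R\<^esub> = 0" "M \<oplus>\<^bsub>?R\<^esub> N = M + N" "M \<otimes>\<^bsub>?R\<^esub> N = M ** N" for M N
    by (simp_all add: mat2_ring_def)
  obtain M where M: "w = Inr M" "M \<in> carrier ?R"
    using w by (auto simp: A image_ring_carrier)
  have "B \<noteq> {0}" "B \<noteq> carrier ?R"
    using nonzero proper B(1) by (auto simp: A image_ring_carrier image_ring_zero ops)
  then have "M \<in> B \<longleftrightarrow> (\<forall>C\<in>B. M ** adjugate2 C = 0)"
    by (intro mat2_proper_left_ideal_eq_annihilator[where S = "entry_field j"] M(2) B[unfolded ops])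
       (auto simp: entry_field_def intro: adjoin_closed adjoin_inverse_closed)
  then show ?thesis using B(1) M(1) by auto
qed

section \<open>Self-dual dihedral codes\<close>

text \<open>By \<open>dual_code_left_ideal\<close>, \<open>x\<close> is in the dual code iff every product \<open>x c'\<close> vanishes,
  and such a product vanishes iff all its images under the \<open>\<tau>\<^sub>j\<close> do.\<close>

lemma dual_code_iff_components_orthogonal:
  assumes ideal: "left_ideal I (dihedral_algebra n)"
  shows "x \<in> dual_code (dihedral_group n) I \<longleftrightarrow>
    x \<in> carrier (dihedral_algebra n) \<and>
    (\<forall>j\<in>{1..r + s}. \<forall>c\<in>I. component_orthogonal (\<P> j x) (\<P> j c))"
proof -
  let ?D = "dihedral_algebra n :: (bool \<times> nat \<Rightarrow> 'k) ring"
  let ?bar = "antipode (dihedral_group n)"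
  have group: "group (dihedral_group n)" by (rule dihedral_group_is_group[OF n_ge_1])
  have tau: "\<tau> j (x \<otimes>\<^bsub>?D\<^esub> ?bar c) = \<tau> j x ** adjugate2 (\<tau> j c)"
    if "j \<in> {1..r + s}" for j c
    by (simp only: tau_map_mult[OF n_ge_1 \<alpha>_power[OF that]]
        tau_map_antipode[OF n_ge_1 \<alpha>_power[OF that] char2_closure])
  have "x \<otimes>\<^bsub>?D\<^esub> ?bar c = \<zero>\<^bsub>?D\<^esub> \<longleftrightarrow>
      (\<forall>j\<in>{1..r + s}. component_orthogonal (\<P> j x) (\<P> j c))" for c
  proof
    assume "x \<otimes>\<^bsub>?D\<^esub> ?bar c = \<zero>\<^bsub>?D\<^esub>"
    moreover have "\<tau> j \<zero>\<^bsub>?D\<^esub> = 0" for j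
      by (simp add: tau_map_eq_0_iff P_poly_def Q_poly_def group_algebra_def)
    ultimately show "\<forall>j\<in>{1..r + s}. component_orthogonal (\<P> j x) (\<P> j c)"
      using tau component_orthogonal_\<P>_iff by metis
  next
    assume "\<forall>j\<in>{1..r + s}. component_orthogonal (\<P> j x) (\<P> j c)"
    then have "\<tau> j (x \<otimes>\<^bsub>?D\<^esub> ?bar c) = 0" if "j \<in> {1..r + s}" for j
      using that by (simp add: tau component_orthogonal_\<P>_iff)
    moreover have "x \<otimes>\<^bsub>?D\<^esub> ?bar c \<in> carrier ?D"
      by (simp add: group_algebra_def)
    ultimately show "x \<otimes>\<^bsub>?D\<^esub> ?bar c = \<zero>\<^bsub>?D\<^esub>"
      by (intro eq_zero_if_tau_maps_vanish)
  qed
  then show ?thesis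
    using dual_code_left_ideal[OF group finite_dihedral_group ideal, of x] by blast
qed

lemma decomposition_map_inj:
  "inj_on (decomposition_map n r s \<alpha>) (carrier (dihedral_algebra n))"
proof (rule inj_onI)
  fix u v :: "bool \<times> nat \<Rightarrow> 'k"
  assume uv: "u \<in> carrier (dihedral_algebra n)" "v \<in> carrier (dihedral_algebra n)"
    and eq: "decomposition_map n r s \<alpha> u = decomposition_map n r s \<alpha> v"
  define w where "w = (\<lambda>g. u g - v g)"
  have eval: "ac_eval (P_poly n w) x = ac_eval (P_poly n u) x - ac_eval (P_poly n v) x"
    "ac_eval (Q_poly n w) x = ac_eval (Q_poly n u) x - ac_eval (Q_poly n v) x" for x
    by (simp_all add: P_poly_def Q_poly_def w_def ac_eval_sum sum_subtractf algebra_simps)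
  have "\<tau> j w = 0" if j: "j \<in> {1..r + s}" for j
  proof -
    have \<P>: "\<P> j u = \<P> j v"
      using fun_cong[OF eq, of j] j by (simp add: decomposition_map_def)
    have tau_diff: "\<tau> j w = \<tau> j u - \<tau> j v"
      by (simp add: tau_map_def vec_eq_iff forall_2 eval)
    show ?thesis
    proof (cases "j = 1")
      case True
      have "gamma_map n 1 u = gamma_map n 1 v"
        using \<P> unfolding True \<P>_1 by simp
      then show ?thesis unfolding tau_diff unfolding True \<tau>_1 by (simp add: gamma_map_def)
    next
      case False
      show ?thesis
      proof (cases "j \<le> r")
        case True
        have "sigma_map (\<alpha> j) (\<tau> j u - \<tau> j v) = sigma_map (\<alpha> j) (\<tau> j u) - sigma_map (\<alpha> j) (\<tau> j v)"
          by (simp add: sigma_map_def mat2_simps algebra_simps)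
        then have "sigma_map (\<alpha> j) (\<tau> j u - \<tau> j v) = 0"
          using \<P> True by (simp add: \<P>_matrix[OF j False])
        then show ?thesis
          by (simp add: tau_diff sigma_map_eq_0_iff[OF \<alpha>_neq_inverse[OF j False]])
      next
        case False
        then show ?thesis using \<P> \<P>_matrix[OF j \<open>j \<noteq> 1\<close>] tau_diff by simp
      qed
    qed
  qed
  moreover have "w \<in> carrier (dihedral_algebra n)"
    using uv by (simp add: w_def group_algebra_def)
  ultimately have "w = \<zero>\<^bsub>dihedral_algebra n\<^esub>"
    by (intro eq_zero_if_tau_maps_vanish)
  then show "u = v" by (auto simp: w_def group_algebra_def fun_eq_iff)
qed

end

theorem corollary2:
  fixes n r s :: nat
    and f :: "nat \<Rightarrow> 'k::{field,finite} poly"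
    and \<alpha> :: "nat \<Rightarrow> 'k alg_closure"
    and I :: "(bool \<times> nat \<Rightarrow> 'k) set"
    and B :: "nat \<Rightarrow> 'k component set"
  assumes "even CARD('k)"
    and "n \<ge> 2"
    and "coprime CARD('k) n"
    and "dihedral_factorization n r s f"
    and "\<And>j. j \<in> {1..r + s} \<Longrightarrow> ac_eval (f j) (\<alpha> j) = 0"
    and "left_ideal I (dihedral_algebra n)"
    and "\<And>j. j \<in> {1..r + s} \<Longrightarrow> left_ideal (B j) (component_algebra n r \<alpha> j)"
    and "decomposition_map n r s \<alpha> ` I = (\<Pi>\<^sub>E j\<in>{1..r + s}. B j)"
  shows "I = dual_code (dihedral_group n) I \<longleftrightarrow>
    (\<forall>j\<in>{1..r + s}. B j \<noteq> {\<zero>\<^bsub>component_algebra n r \<alpha> j\<^esub>} \<and>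
                     B j \<noteq> carrier (component_algebra n r \<alpha> j))"
proof -
  interpret dihedral_decomposition_char2 n r s f \<alpha>
    by unfold_locales (fact assms)+
  let ?dual = "dual_code (dihedral_group n) I"
  let ?\<phi> = "decomposition_map n r s \<alpha>"
  have I_sub: "I \<subseteq> carrier (dihedral_algebra n)"
    using assms(6) by (auto simp: left_ideal_def dest: additive_subgroup.a_Hcarr)
  have "?\<phi> ` I \<noteq> {}"
    using assms(6) by (auto simp: left_ideal_def dest: additive_subgroup.zero_closed)
  then have nonempty: "(\<Pi>\<^sub>E j\<in>{1..r + s}. B j) \<noteq> {}" unfolding assms(8) .
  \<comment> \<open>A member of one \<open>B\<^sub>j\<close> extends to a member of the product, since the other ideals are nonempty.\<close>
  have image: "\<P> j ` I = B j" if j: "j \<in> {1..r + s}" for j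
  proof -
    have "\<P> j ` I = (\<lambda>b. b j) ` (?\<phi> ` I)"
      using j by (simp add: image_image decomposition_map_def)
    also have "\<dots> = B j"
    proof
      show "(\<lambda>b. b j) ` (?\<phi> ` I) \<subseteq> B j"
        using j unfolding assms(8) by auto
      show "B j \<subseteq> (\<lambda>b. b j) ` (?\<phi> ` I)"
      proof
        fix c assume "c \<in> B j"
        obtain b where "b \<in> (\<Pi>\<^sub>E j\<in>{1..r + s}. B j)" using nonempty by blast
        then have "b(j := c) \<in> (\<Pi>\<^sub>E j\<in>{1..r + s}. B j)"
          using \<open>c \<in> B j\<close> j by (auto simp: PiE_iff extensional_def)
        then show "c \<in> (\<lambda>b. b j) ` (?\<phi> ` I)"
          unfolding assms(8) by (rule rev_image_eqI) simp
      qed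
    qed
    finally show ?thesis .
  qed
  have mem_I: "x \<in> I \<longleftrightarrow> (\<forall>j\<in>{1..r + s}. \<P> j x \<in> B j)" if x: "x \<in> carrier (dihedral_algebra n)" for x
  proof -
    have "x \<in> I \<longleftrightarrow> ?\<phi> x \<in> ?\<phi> ` I"
      using decomposition_map_inj I_sub x by (metis inj_on_image_mem_iff)
    then show ?thesis
      unfolding assms(8) by (simp add: decomposition_map_def PiE_iff)
  qed
  have dual: "x \<in> ?dual \<longleftrightarrow> x \<in> carrier (dihedral_algebra n) \<and>
      (\<forall>j\<in>{1..r + s}. \<forall>c\<in>B j. component_orthogonal (\<P> j x) c)" for x
    unfolding dual_code_iff_components_orthogonal[OF assms(6)] by (simp add: image[symmetric])
  show ?thesis
  proof
    assume proper: "\<forall>j\<in>{1..r + s}. B j \<noteq> {\<zero>\<^bsub>A j\<^esub>} \<and> B j \<noteq> carrier (A j)"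
    have "x \<in> I \<longleftrightarrow> x \<in> ?dual" if x: "x \<in> carrier (dihedral_algebra n)" for x
    proof -
      have "\<P> j x \<in> B j \<longleftrightarrow> (\<forall>c\<in>B j. component_orthogonal (\<P> j x) c)" if "j \<in> {1..r + s}" for j
        using proper_left_ideal_eq_annihilator[OF that assms(7)[OF that] _ _ \<P>_in_carrier[OF that]]
          proper that by blast
      then show ?thesis using x by (simp add: mem_I[OF x] dual)
    qed
    then show "I = ?dual" using I_sub dual by blast
  next
    assume self_dual: "I = ?dual"
    show "\<forall>j\<in>{1..r + s}. B j \<noteq> {\<zero>\<^bsub>A j\<^esub>} \<and> B j \<noteq> carrier (A j)"
    proof (intro ballI conjI notI)
      fix j assume j: "j \<in> {1..r + s}" and full: "B j = carrier (A j)"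
      then obtain c where "c \<in> I" "\<P> j c = \<one>\<^bsub>A j\<^esub>"
        using image[OF j] one_not_self_orthogonal(1)[OF j] by (metis imageE)
      moreover have "component_orthogonal (\<P> j c) (\<P> j c)"
        using self_dual \<open>c \<in> I\<close> dual image[OF j] j by blast
      ultimately show False using one_not_self_orthogonal(2)[OF j] by simp
    next
      fix j assume j: "j \<in> {1..r + s}" and trivial: "B j = {\<zero>\<^bsub>A j\<^esub>}"
      obtain u where u: "u \<in> carrier (dihedral_algebra n)" "u \<noteq> \<zero>\<^bsub>dihedral_algebra n\<^esub>"
        and vanish: "\<And>i. i \<in> {1..r + s} \<Longrightarrow> i \<noteq> j \<Longrightarrow> \<tau> i u = 0"
        by (rule ex_supported_on_component[OF j]) (rule that)
      have "component_orthogonal (\<P> i u) (\<P> i c)" if i: "i \<in> {1..r + s}" and c: "c \<in> I" for i c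
      proof (cases "i = j")
        case True
        have "\<P> j c = \<zero>\<^bsub>A j\<^esub>" using image[OF j] trivial c by blast
        then show ?thesis
          using True j by (simp add: \<P>_eq_zero_iff component_orthogonal_\<P>_iff)
            (simp add: mat2_simps)
      next
        case False
        then show ?thesis by (simp add: component_orthogonal_\<P>_iff[OF i] vanish[OF i])
      qed
      then have "u \<in> I"
        using u(1) self_dual dual_code_iff_components_orthogonal[OF assms(6), of u] by blast
      then have "\<P> j u = \<zero>\<^bsub>A j\<^esub>" using image[OF j] trivial by blast
      then have "\<tau> j u = 0" by (simp add: \<P>_eq_zero_iff[OF j])
      then have "u = \<zero>\<^bsub>dihedral_algebra n\<^esub>"
        using eq_zero_if_tau_maps_vanish[OF u(1)] vanish by metis
      then show False using u(2) by contradiction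
    qed
  qed
qed

end
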